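(* Let $(E,\tau,M,\rho)$ be a Lie algebroid over a smooth manifold $M$. The $\Omega(M,E)$-valued exterior derivative $d_\rho$ has the following properties. 1. For each $V\in A^1(M,E)$, $\mathcal L_\rho(V)=i(V)\circ d_\rho+d_\rho\circ i(V)$ on $\Omega(M,E)$. 2. $d_\rho$ is a derivation of degree $1$ of the exterior algebra $\Omega(M,E)$: for each $p\in\mathbb Z$, $\eta\in\Omega^p(M,E)$ and $\zeta\in\Omega(M,E)$, $d_\rho(\eta\wedge\zeta)=d_\rho\eta\wedge\zeta+(-1)^p\eta\wedge d_\rho\zeta$. 3. For each $V\in A^1(M,E)$, $\mathcal L_\rho(V)\circ d_\rho=d_\rho\circ\mathcal L_\rho(V)$. 4. The square of $d_\rho$ vanishes identically: $d_\rho\circ d_\rho=0$.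
   Context: A Lie algebroid $(E,\tau,M,\rho)$ is a smooth real vector bundle $\tau:E\to M$ of finite rank over a smooth manifold, with a real Lie algebra bracket $\{\ ,\ \}$ on its smooth sections and a smooth vector bundle map $\rho:E\to TM$ over $\mathrm{id}_M$ (anchor) such that $\{s_1,fs_2\}=f\{s_1,s_2\}+(\mathcal L(\rho\circ s_1)f)s_2$. $A^1(M,E)$ is the space of smooth sections of $E$; $\Omega^p(M,E)$ the space of smooth sections of $\bigwedge^pE^*$ ($C^\infty(M,\mathbb R)$ for $p=0$, $\{0\}$ for $p<0$), identified with alternating $C^\infty(M,\mathbb R)$-multilinear forms on $A^1(M,E)$; $\Omega(M,E)=\bigoplus_p\Omega^p(M,E)$. The wedge product is given by the sum over $(p,q)$-shuffles (no normalizing factor). $i(V)$ inserts $V$ as first argument and is $0$ on $\Omega^0(M,E)$. $\mathcal L_\rho(V)$ is the degree $0$ linear endomorphism of $\Omega(M,E)$ with $\mathcal L_\rho(V)f=\mathcal L(\rho\circ V)f$ for functions and, for $\eta\in\Omega^p(M,E)$, $p>0$, $(\mathcal L_\rho(V)\eta)(V_1,\dots,V_p)=\mathcal L_\rho(V)(\eta(V_1,\dots,V_p))-\sum_{i=1}^p\eta(V_1,\dots,V_{i-1},\{V,V_i\},V_{i+1},\dots,V_p)$. $d_\rho$ is the degree $1$ linear endomorphism of $\Omega(M,E)$ with $\langle d_\rho f,V\rangle=\mathcal L(\rho\circ V)f$ for functions and, for $\eta\in\Omega^p(M,E)$, $p\ge1$, $$d_\rho\eta(V_0,\dots,V_p)=\sum_{i=0}^p(-1)^i\mathcal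 L_\rho(V_i)\bigl(\eta(V_0,\dots,\widehat V_i,\dots,V_p)\bigr)+\sum_{0\le i<j\le p}(-1)^{i+j}\eta\bigl(\{V_i,V_j\},V_0,\dots,\widehat V_i,\dots,\widehat V_j,\dots,V_p\bigr).$$ *)

theory Defs
  imports "HOL-Analysis.Analysis"
begin

section \<open>Model spaces\<close>

text \<open>Finite-dimensional real inner product spaces.  In contrast to \<^class>\<open>euclidean_space\<close> the
  dimension may be \<open>0\<close>, so that Lie algebras (Lie algebroids over a point) and bundles of rank
  \<open>0\<close> are covered; the type \<open>origin\<close> below is the model space of dimension \<open>0\<close>.\<close>

class fin_euclidean = real_inner +
  assumes finite_orthonormal_basis:
    "\<exists>B. finite B \<and> (\<forall>u\<in>B. \<forall>v\<in>B. inner u v = (if u = v then 1 else 0)) \<and>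
         (\<forall>x. (\<forall>u\<in>B. inner x u = 0) \<longrightarrow> x = 0)"

instance euclidean_space \<subseteq> fin_euclidean
proof
  show "\<exists>B::'a set. finite B \<and> (\<forall>u\<in>B. \<forall>v\<in>B. inner u v = (if u = v then 1 else 0)) \<and>
         (\<forall>x. (\<forall>u\<in>B. inner x u = 0) \<longrightarrow> x = 0)"
    by (rule exI[of _ Basis]) (simp add: inner_Basis euclidean_all_zero_iff)
qed

datatype origin = Origin

instantiation origin :: fin_euclidean
begin

definition "(0::origin) = Origin"
definition "(x::origin) + y = Origin"
definition "(x::origin) - y = Origin"
definition "- (x::origin) = Origin"
definition "(c::real) *\<^sub>R (x::origin) = Origin"
definition "norm (x::origin) = 0"
definition "dist (x::origin) y = 0"
definition "sgn (x::origin) = Origin"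
definition "inner (x::origin) y = 0"
definition "(uniformity :: (origin \<times> origin) filter) =
  (INF e\<in>{0<..}. principal {(x, y). dist x y < e})"
definition "open (U :: origin set) \<longleftrightarrow>
  (\<forall>x\<in>U. \<forall>\<^sub>F (x', y) in uniformity. x' = x \<longrightarrow> y \<in> U)"

instance
proof
  have all_eq: "x = y" for x y :: origin
    by (cases x; cases y) simp
  show "\<exists>B::origin set. finite B \<and> (\<forall>u\<in>B. \<forall>v\<in>B. inner u v = (if u = v then 1 else 0)) \<and>
         (\<forall>x. (\<forall>u\<in>B. inner x u = 0) \<longrightarrow> x = 0)"
    using all_eq by (intro exI[of _ "{}"]) auto
  show "inner x x = 0 \<longleftrightarrow> x = 0" for x :: origin
    using all_eq[of x 0] by (simp add: inner_origin_def)
  show "0 + x = x" "1 *\<^sub>R x = x" for x :: origin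
    by (rule all_eq)+
qed (simp_all add: zero_origin_def plus_origin_def minus_origin_def uminus_origin_def
      scaleR_origin_def norm_origin_def dist_origin_def sgn_origin_def inner_origin_def
      uniformity_origin_def open_origin_def)

end


section \<open>Smooth manifolds\<close>

primrec Ck_on :: "nat \<Rightarrow> 'a::real_normed_vector set \<Rightarrow> ('a \<Rightarrow> 'b::real_normed_vector) \<Rightarrow> bool" where
  "Ck_on 0 S f \<longleftrightarrow> continuous_on S f"
| "Ck_on (Suc k) S f \<longleftrightarrow> (\<forall>x\<in>S. f differentiable at x) \<and>
     (\<forall>v. Ck_on k S (\<lambda>x. frechet_derivative f (at x) v))"

text \<open>Only used for open \<open>S\<close> in finite-dimensional spaces, where this is the usual notion.\<close>

definition smooth_on :: "'a::real_normed_vector set \<Rightarrow> ('a \<Rightarrow> 'b::real_normed_vector) \<Rightarrow> bool" where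
  "smooth_on S f \<longleftrightarrow> (\<forall>k. Ck_on k S f)"

text \<open>A chart is a pair of its domain and its coordinate map; the values of the coordinate map
  outside the domain are irrelevant.\<close>

type_synonym ('m, 'e) chart = "'m set \<times> ('m \<Rightarrow> 'e)"

definition smooth_compatible :: "('m, 'e::real_normed_vector) chart set \<Rightarrow> bool" where
  "smooth_compatible A \<longleftrightarrow>
     (\<forall>(U, \<phi>)\<in>A. \<forall>(W, \<psi>)\<in>A. open (\<phi> ` (U \<inter> W)) \<and> smooth_on (\<phi> ` (U \<inter> W)) (\<psi> \<circ> inv_into U \<phi>))"

text \<open>The manifold is the whole type \<open>'m\<close>, a Hausdorff and second countable space.\<close>

definition smooth_manifold ::
  "('m::{t2_space,second_countable_topology}, 'e::fin_euclidean) chart set \<Rightarrow> bool" where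
  "smooth_manifold A \<longleftrightarrow>
     \<Union>(fst ` A) = UNIV \<and>
     (\<forall>(U, \<phi>)\<in>A. open U \<and> open (\<phi> ` U) \<and> homeomorphism U (\<phi> ` U) \<phi> (inv_into U \<phi>)) \<and>
     smooth_compatible A"

text \<open>Smooth maps between manifolds given by atlases.  Openness of \<open>\<phi> ` (U \<inter> F -` W)\<close> expresses
  continuity.\<close>

definition smooth_map ::
  "('m, 'e::real_normed_vector) chart set \<Rightarrow> ('n, 'f::real_normed_vector) chart set \<Rightarrow> ('m \<Rightarrow> 'n) \<Rightarrow> bool"
where
  "smooth_map A B F \<longleftrightarrow>
     (\<forall>(U, \<phi>)\<in>A. F ` U \<subseteq> \<Union>(fst ` B) \<and>
        (\<forall>(W, \<psi>)\<in>B. open (\<phi> ` (U \<inter> F -` W)) \<and>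
           smooth_on (\<phi> ` (U \<inter> F -` W)) (\<psi> \<circ> F \<circ> inv_into U \<phi>)))"

definition smooth_functions :: "('m, 'e::real_normed_vector) chart set \<Rightarrow> ('m \<Rightarrow> real) set" where
  "smooth_functions A = {f. smooth_map A {(UNIV, id)} f}"


section \<open>The tangent bundle and the Lie derivative of functions\<close>

text \<open>A tangent vector at \<open>x\<close> is the family of its coordinate vectors in all charts around \<open>x\<close>,
  which transform by the derivatives of the changes of charts (and is \<open>0\<close> at other indices).\<close>

type_synonym ('m, 'e) tangent = "('m, 'e) chart \<Rightarrow> 'e"

definition tangent_space ::
  "('m, 'e::real_normed_vector) chart set \<Rightarrow> 'm \<Rightarrow> ('m, 'e) tangent set" where
  "tangent_space A x = {v.
     (\<forall>(U, \<phi>)\<in>A. \<forall>(W, \<psi>)\<in>A. x \<in> U \<inter> W \<longrightarrow>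
        v (W, \<psi>) = frechet_derivative (\<psi> \<circ> inv_into U \<phi>) (at (\<phi> x)) (v (U, \<phi>))) \<and>
     (\<forall>c. \<not> (c \<in> A \<and> x \<in> fst c) \<longrightarrow> v c = 0)}"

definition tangent_atlas ::
  "('m, 'e::real_normed_vector) chart set \<Rightarrow> ('m \<times> ('m, 'e) tangent, 'e \<times> 'e) chart set" where
  "tangent_atlas A =
     (\<lambda>(U, \<phi>). ({(x, v). x \<in> U \<and> v \<in> tangent_space A x}, \<lambda>(x, v). (\<phi> x, v (U, \<phi>)))) ` A"

text \<open>Derivative of \<open>f\<close> along a tangent vector; by the chain rule it does not depend on the
  chosen chart.\<close>

definition tangent_apply ::
  "('m, 'e::real_normed_vector) chart set \<Rightarrow> 'm \<times> ('m, 'e) tangent \<Rightarrow> ('m \<Rightarrow> real) \<Rightarrow> real" where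
  "tangent_apply A w f =
     (let (x, v) = w; (U, \<phi>) = (SOME c. c \<in> A \<and> x \<in> fst c)
      in frechet_derivative (f \<circ> inv_into U \<phi>) (at (\<phi> x)) (v (U, \<phi>)))"

definition lie_derivative ::
  "('m, 'e::real_normed_vector) chart set \<Rightarrow> ('m \<Rightarrow> 'm \<times> ('m, 'e) tangent) \<Rightarrow> ('m \<Rightarrow> real) \<Rightarrow> 'm \<Rightarrow> real"
where
  "lie_derivative A X f = (\<lambda>x. tangent_apply A (X x) f)"


section \<open>Smooth vector bundles\<close>

text \<open>The total space is the whole type \<open>'v\<close>; \<open>vadd\<close> and \<open>vscale\<close> are the vector space operations
  of the fibres.  A trivialization over \<open>W\<close> is given by \<open>W\<close> and the fibre component
  \<open>\<psi>\<close> of the map \<open>v \<mapsto> (proj v, \<psi> v)\<close> from the part of the bundle over \<open>W\<close> to \<open>W \<times> 'f\<close>.\<close>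

record ('m, 'e, 'v, 'f) vector_bundle_data =
  base_atlas :: "('m, 'e) chart set"
  proj :: "'v \<Rightarrow> 'm"
  vadd :: "'v \<Rightarrow> 'v \<Rightarrow> 'v"
  vscale :: "real \<Rightarrow> 'v \<Rightarrow> 'v"
  trivializations :: "('m set \<times> ('v \<Rightarrow> 'f)) set"

definition fibre :: "('m, 'e, 'v, 'f, 'z) vector_bundle_data_scheme \<Rightarrow> 'm \<Rightarrow> 'v set" where
  "fibre G x = {v. proj G v = x}"

text \<open>The bundle charts \<open>v \<mapsto> (\<phi> (proj v), \<psi> v)\<close>; they define the smooth structure of the total
  space.\<close>

definition total_atlas ::
  "('m, 'e, 'v, 'f, 'z) vector_bundle_data_scheme \<Rightarrow> ('v, 'e \<times> 'f) chart set" where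
  "total_atlas G =
     {({v. proj G v \<in> U \<inter> W}, \<lambda>v. (\<phi> (proj G v), \<psi> v)) | U \<phi> W \<psi>.
        (U, \<phi>) \<in> base_atlas G \<and> (W, \<psi>) \<in> trivializations G}"

text \<open>Since every \<open>\<psi>\<close> is a bijection from each fibre onto the vector space \<open>'f\<close> that respects
  the operations, the fibres are vector spaces and \<open>\<psi>\<close> is a linear isomorphism on them.\<close>

definition vector_bundle ::
  "('m::{t2_space,second_countable_topology}, 'e::fin_euclidean, 'v, 'f::fin_euclidean, 'z)
     vector_bundle_data_scheme \<Rightarrow> bool" where
  "vector_bundle G \<longleftrightarrow>
     smooth_manifold (base_atlas G) \<and>
     (\<forall>x. \<forall>v\<in>fibre G x. \<forall>w\<in>fibre G x. vadd G v w \<in> fibre G x) \<and>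
     (\<forall>x. \<forall>v\<in>fibre G x. \<forall>c. vscale G c v \<in> fibre G x) \<and>
     \<Union>(fst ` trivializations G) = UNIV \<and>
     (\<forall>(W, \<psi>)\<in>trivializations G. open W \<and>
        (\<forall>x\<in>W. bij_betw \<psi> (fibre G x) UNIV \<and>
           (\<forall>v\<in>fibre G x. \<forall>w\<in>fibre G x. \<psi> (vadd G v w) = \<psi> v + \<psi> w) \<and>
           (\<forall>v\<in>fibre G x. \<forall>c. \<psi> (vscale G c v) = c *\<^sub>R \<psi> v))) \<and>
     smooth_compatible (total_atlas G)"

type_synonym ('m, 'v) sect = "'m \<Rightarrow> 'v"

definition A1 ::
  "('m, 'e::real_normed_vector, 'v, 'f::real_normed_vector, 'z) vector_bundle_data_scheme \<Rightarrow> ('m, 'v) sect set"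
where
  "A1 G = {s. (\<forall>x. proj G (s x) = x) \<and> smooth_map (base_atlas G) (total_atlas G) s}"

definition sadd ::
  "('m, 'e, 'v, 'f, 'z) vector_bundle_data_scheme \<Rightarrow> ('m, 'v) sect \<Rightarrow> ('m, 'v) sect \<Rightarrow> ('m, 'v) sect" where
  "sadd G s t = (\<lambda>x. vadd G (s x) (t x))"

definition smult ::
  "('m, 'e, 'v, 'f, 'z) vector_bundle_data_scheme \<Rightarrow> ('m \<Rightarrow> real) \<Rightarrow> ('m, 'v) sect \<Rightarrow> ('m, 'v) sect" where
  "smult G f s = (\<lambda>x. vscale G (f x) (s x))"

definition szero :: "('m, 'e, 'v, 'f, 'z) vector_bundle_data_scheme \<Rightarrow> ('m, 'v) sect" where
  "szero G = (\<lambda>x. THE z. z \<in> fibre G x \<and> (\<forall>v\<in>fibre G x. vadd G z v = v))"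


section \<open>Lie algebroids\<close>

record ('m, 'e, 'v, 'f) lie_algebroid_data = "('m, 'e, 'v, 'f) vector_bundle_data" +
  bracket :: "('m, 'v) sect \<Rightarrow> ('m, 'v) sect \<Rightarrow> ('m, 'v) sect"
  anchor :: "'v \<Rightarrow> 'm \<times> ('m, 'e) tangent"

definition lie_bracket_on_sections ::
  "('m, 'e::real_normed_vector, 'v, 'f::real_normed_vector) lie_algebroid_data \<Rightarrow> bool" where
  "lie_bracket_on_sections G \<longleftrightarrow>
     (\<forall>s\<in>A1 G. \<forall>t\<in>A1 G. bracket G s t \<in> A1 G) \<and>
     (\<forall>s\<in>A1 G. \<forall>t\<in>A1 G. \<forall>u\<in>A1 G.
        bracket G (sadd G s t) u = sadd G (bracket G s u) (bracket G t u) \<and>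
        bracket G u (sadd G s t) = sadd G (bracket G u s) (bracket G u t)) \<and>
     (\<forall>s\<in>A1 G. \<forall>t\<in>A1 G. \<forall>c.
        bracket G (smult G (\<lambda>_. c) s) t = smult G (\<lambda>_. c) (bracket G s t) \<and>
        bracket G s (smult G (\<lambda>_. c) t) = smult G (\<lambda>_. c) (bracket G s t)) \<and>
     (\<forall>s\<in>A1 G. bracket G s s = szero G) \<and>
     (\<forall>s\<in>A1 G. \<forall>t\<in>A1 G. \<forall>u\<in>A1 G.
        sadd G (bracket G s (bracket G t u))
          (sadd G (bracket G t (bracket G u s)) (bracket G u (bracket G s t))) = szero G)"

definition anchor_bundle_map ::
  "('m, 'e::real_normed_vector, 'v, 'f::real_normed_vector) lie_algebroid_data \<Rightarrow> bool" where
  "anchor_bundle_map G \<longleftrightarrow>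
     smooth_map (total_atlas G) (tangent_atlas (base_atlas G)) (anchor G) \<and>
     (\<forall>v. fst (anchor G v) = proj G v) \<and>
     (\<forall>x. \<forall>v\<in>fibre G x. \<forall>w\<in>fibre G x.
        snd (anchor G (vadd G v w)) = (\<lambda>c. snd (anchor G v) c + snd (anchor G w) c)) \<and>
     (\<forall>v a. snd (anchor G (vscale G a v)) = (\<lambda>c. a *\<^sub>R snd (anchor G v) c))"

text \<open>The Lie derivative of functions along \<open>\<rho> \<circ> V\<close>.\<close>

definition lie_fun ::
  "('m, 'e::real_normed_vector, 'v, 'f) lie_algebroid_data \<Rightarrow> ('m, 'v) sect \<Rightarrow> ('m \<Rightarrow> real) \<Rightarrow> 'm \<Rightarrow> real"
where
  "lie_fun G V f = lie_derivative (base_atlas G) (anchor G \<circ> V) f"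

definition lie_algebroid ::
  "('m::{t2_space,second_countable_topology}, 'e::fin_euclidean, 'v, 'f::fin_euclidean)
     lie_algebroid_data \<Rightarrow> bool" where
  "lie_algebroid G \<longleftrightarrow>
     vector_bundle G \<and> lie_bracket_on_sections G \<and> anchor_bundle_map G \<and>
     (\<forall>s\<in>A1 G. \<forall>t\<in>A1 G. \<forall>f\<in>smooth_functions (base_atlas G).
        bracket G s (smult G f t) = sadd G (smult G f (bracket G s t)) (smult G (lie_fun G s f) t))"


section \<open>The exterior algebra\<close>

text \<open>A form takes the list of its arguments, so that the degree of a homogeneous form is the length
  of the lists on which it lives; a form of degree \<open>0\<close> is the function that is its value at the
  empty list.  Forms vanish at all other lists, so that equality of forms is equality of HOL
  functions, and the sum of forms of different degrees is the direct sum.\<close>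

type_synonym ('m, 'v) form = "('m, 'v) sect list \<Rightarrow> 'm \<Rightarrow> real"

definition Omega_deg ::
  "('m, 'e::real_normed_vector, 'v, 'f::real_normed_vector) lie_algebroid_data \<Rightarrow> int \<Rightarrow> ('m, 'v) form set"
where
  "Omega_deg G p =
     (if p < 0 then {\<lambda>_ _. 0}
      else {\<eta>.
        (\<forall>Vs. \<not> (int (length Vs) = p \<and> set Vs \<subseteq> A1 G) \<longrightarrow> \<eta> Vs = (\<lambda>_. 0)) \<and>
        (\<forall>Vs. int (length Vs) = p \<and> set Vs \<subseteq> A1 G \<longrightarrow>
           \<eta> Vs \<in> smooth_functions (base_atlas G) \<and>
           (\<not> distinct Vs \<longrightarrow> \<eta> Vs = (\<lambda>_. 0)) \<and>
           (\<forall>i<length Vs. \<forall>s\<in>A1 G. \<forall>t\<in>A1 G.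
              \<eta> (Vs[i := sadd G s t]) = (\<lambda>x. \<eta> (Vs[i := s]) x + \<eta> (Vs[i := t]) x)) \<and>
           (\<forall>i<length Vs. \<forall>s\<in>A1 G. \<forall>f\<in>smooth_functions (base_atlas G).
              \<eta> (Vs[i := smult G f s]) = (\<lambda>x. f x * \<eta> (Vs[i := s]) x)))})"

definition Omega ::
  "('m, 'e::real_normed_vector, 'v, 'f::real_normed_vector) lie_algebroid_data \<Rightarrow> ('m, 'v) form set"
where
  "Omega G = {\<omega>. \<exists>N \<eta>. (\<forall>p\<le>N. \<eta> p \<in> Omega_deg G (int p)) \<and> \<omega> = (\<lambda>Vs x. \<Sum>p\<le>N. \<eta> p Vs x)}"

text \<open>The arguments are numbered from \<open>0\<close>.\<close>

definition shuffle_perms :: "nat \<Rightarrow> nat \<Rightarrow> (nat \<Rightarrow> nat) set" where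
  "shuffle_perms p q = {\<sigma>. \<sigma> permutes {..<p + q} \<and> strict_mono_on {..<p} \<sigma> \<and> strict_mono_on {p..<p + q} \<sigma>}"

text \<open>The summand with index \<open>p\<close> is the product of the component of degree \<open>p\<close> of \<open>\<eta>\<close> and that of
  complementary degree of \<open>\<zeta>\<close>.\<close>

definition wedge :: "('m, 'v) form \<Rightarrow> ('m, 'v) form \<Rightarrow> ('m, 'v) form" where
  "wedge \<eta> \<zeta> = (\<lambda>Vs x. \<Sum>p\<le>length Vs. \<Sum>\<sigma>\<in>shuffle_perms p (length Vs - p).
     of_int (sign \<sigma>) * \<eta> (map (\<lambda>k. Vs ! \<sigma> k) [0..<p]) x
                     * \<zeta> (map (\<lambda>k. Vs ! \<sigma> k) [p..<length Vs]) x)"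

definition insert_sect :: "('m, 'v) sect \<Rightarrow> ('m, 'v) form \<Rightarrow> ('m, 'v) form" where
  "insert_sect V \<omega> = (\<lambda>Vs. \<omega> (V # Vs))"

definition lie_form ::
  "('m, 'e::real_normed_vector, 'v, 'f::real_normed_vector) lie_algebroid_data \<Rightarrow> ('m, 'v) sect \<Rightarrow> ('m, 'v) form \<Rightarrow> ('m, 'v) form"
where
  "lie_form G V \<omega> = (\<lambda>Vs x. if set Vs \<subseteq> A1 G
     then lie_fun G V (\<omega> Vs) x - (\<Sum>i<length Vs. \<omega> (Vs[i := bracket G V (Vs ! i)]) x)
     else 0)"

text \<open>\<open>nths Vs (- {i})\<close> and \<open>nths Vs (- {i, j})\<close> are \<open>Vs\<close> with the entries at \<open>i\<close>, respectively
  \<open>i\<close> and \<open>j\<close>, omitted.\<close>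

definition d_rho ::
  "('m, 'e::real_normed_vector, 'v, 'f::real_normed_vector) lie_algebroid_data \<Rightarrow> ('m, 'v) form \<Rightarrow> ('m, 'v) form"
where
  "d_rho G \<omega> = (\<lambda>Vs x. if set Vs \<subseteq> A1 G
     then (\<Sum>i<length Vs. (-1) ^ i * lie_fun G (Vs ! i) (\<omega> (nths Vs (- {i}))) x)
        + (\<Sum>j<length Vs. \<Sum>i<j. (-1) ^ (i + j) * \<omega> (bracket G (Vs ! i) (Vs ! j) # nths Vs (- {i, j})) x)
     else 0)"

end

theory Submission
  imports Defs "HOL-Library.Function_Algebras"
begin

text \<open>Everything reduces to Lie-Rinehart calculus, once \<open>\<L>(\<rho> \<circ> [V, W]) = [\<L>(\<rho> \<circ> V), \<L>(\<rho> \<circ> W)]\<close> on functions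
  is known; this follows from the Jacobi identity and the Leibniz rule.  Cartan's formula (1) is the
  defining formula of \<open>d\<close> with the terms containing the first argument split off.  Read as
  \<open>i(V) d = L(V) - d i(V)\<close> it is a recursion for \<open>d\<close> on the number of arguments, and so are
  \<open>i(W) L(V) = L(V) i(W) - i([V, W])\<close> for the Lie derivative and
  \<open>i(V) (\<eta> \<and> \<zeta>) = i(V) \<eta> \<and> \<zeta> + (-1)\<^sup>p \<eta> \<and> i(V) \<zeta>\<close> for the wedge product.  All remaining
  assertions are proved by induction on the number of arguments with these three recursions.\<close>

section \<open>Functions of class \<open>C\<^sup>k\<close>\<close>

text \<open>The smooth functions are a subset \<open>C\<close> of the ring of all real functions on
  the manifold, and outside \<open>C\<close> the map \<open>lie_fun\<close> has no meaning. So every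
  recursion carries closedness conditions, and an operator must be known to preserve forms before it
  can be applied twice. The delicate case is d: linearity of d\<omega> over functions holds because
  the df terms of L(fV)\<omega> and of d(f i(V)\<omega>) cancel. The algebraic part admits forms of
  mixed and unbounded degree, so that an induction on the arguments never has to keep track of a
  degree; the sign (-1)^p then becomes the operator \<open>parity\<close>. Forms are evaluated on
  global sections throughout and are never localized. The main analytic input is that L(\<rho>
  \<circ> V)f is smooth, which needs derivatives along directions that vary with the point.\<close>

lemma has_derivative_frechet:
  "f differentiable at x \<Longrightarrow> (f has_derivative frechet_derivative f (at x)) (at x)"
  by (simp add: frechet_derivative_works)

lemma frechet_derivative_eqI:
  "(f has_derivative f') (at x) \<Longrightarrow> frechet_derivative f (at x) = f'"
  by (metis frechet_derivative_at)

text \<open>A Frechet derivative depends on the function near the point, so agreement on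
  \<open>S\<close> passes to derivatives because \<open>S\<close> is open.\<close>

lemma Ck_on_cong:
  assumes "open S" "\<And>x. x \<in> S \<Longrightarrow> f x = g x" "Ck_on k S f"
  shows "Ck_on k S g"
  using assms
proof (induction k arbitrary: f g)
  case 0
  then show ?case by (simp cong: continuous_on_cong)
next
  case (Suc k)
  have d: "(g has_derivative frechet_derivative f (at x)) (at x)" if "x \<in> S" for x
  proof (rule has_derivative_transform_within_open[OF _ \<open>open S\<close> that])
    show "(f has_derivative frechet_derivative f (at x)) (at x)"
      using Suc.prems(3) that by (auto intro: has_derivative_frechet)
  qed (use Suc.prems in auto)
  have "Ck_on k S (\<lambda>x. frechet_derivative g (at x) v)" for v
    by (rule Suc.IH[of "\<lambda>x. frechet_derivative f (at x) v"])
      (use Suc.prems frechet_derivative_eqI[OF d] in auto)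
  then show ?case
    by (auto intro: d differentiableI)
qed

lemma Ck_on_SucI:
  assumes "open S" "\<And>x. x \<in> S \<Longrightarrow> (f has_derivative f' x) (at x)"
    and "\<And>v. Ck_on k S (\<lambda>x. f' x v)"
  shows "Ck_on (Suc k) S f"
proof -
  have "Ck_on k S (\<lambda>x. frechet_derivative f (at x) v)" for v
    by (rule Ck_on_cong[OF assms(1) _ assms(3)]) (simp add: frechet_derivative_eqI[OF assms(2)])
  then show ?thesis
    by (auto intro: assms(2) differentiableI)
qed

lemma Ck_on_Suc_has_derivative:
  "Ck_on (Suc k) S f \<Longrightarrow> x \<in> S \<Longrightarrow> (f has_derivative frechet_derivative f (at x)) (at x)"
  by (auto intro: has_derivative_frechet)

lemma Ck_on_Suc_frechet:
  "Ck_on (Suc k) S f \<Longrightarrow> Ck_on k S (\<lambda>x. frechet_derivative f (at x) v)"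
  by simp

lemma Ck_on_subset: "Ck_on k T f \<Longrightarrow> S \<subseteq> T \<Longrightarrow> Ck_on k S f"
  by (induction k arbitrary: f) (auto intro: continuous_on_subset)

text \<open>This allows the coordinates of the anchor to be treated over one trivialization at a
  time.\<close>

lemma Ck_on_local:
  assumes "\<And>x. x \<in> S \<Longrightarrow> \<exists>T. open T \<and> x \<in> T \<and> Ck_on k T f"
  shows "Ck_on k S f"
  using assms
proof (induction k arbitrary: f)
  case 0
  have "isCont f x" if "x \<in> S" for x
    using 0[OF that] by (auto simp: continuous_on_eq_continuous_at)
  then show ?case
    by (auto intro: continuous_at_imp_continuous_on)
next
  case (Suc k)
  have "f differentiable at x" if "x \<in> S" for x
    using Suc.prems[OF that] by auto
  moreover have "Ck_on k S (\<lambda>x. frechet_derivative f (at x) v)" for v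
    by (rule Suc.IH) (use Suc.prems in fastforce)
  ultimately show ?case by simp
qed

lemma Ck_on_SucD: "Ck_on (Suc k) S f \<Longrightarrow> Ck_on k S f"
proof (induction k arbitrary: f)
  case 0
  then show ?case
    by (auto intro!: continuous_at_imp_continuous_on differentiable_imp_continuous_within)
next
  case (Suc k)
  then show ?case by simp
qed

lemma Ck_on_const: "Ck_on k S (\<lambda>x. c)"
  by (induction k arbitrary: c) simp_all

lemma Ck_on_add:
  assumes "open S" "Ck_on k S f" "Ck_on k S g"
  shows "Ck_on k S (\<lambda>x. f x + g x)"
  using assms(2,3)
proof (induction k arbitrary: f g)
  case 0
  then show ?case by (simp add: continuous_on_add)
next
  case (Suc k)
  show ?case
    by (rule Ck_on_SucI[OF \<open>open S\<close> has_derivative_add[OF Ck_on_Suc_has_derivative[OF Suc.prems(1)] Ck_on_Suc_has_derivative[OF Suc.prems(2)]]])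
      (auto intro!: Suc.IH simp: Ck_on_Suc_frechet[OF Suc.prems(1)] Ck_on_Suc_frechet[OF Suc.prems(2)])
qed

lemma Ck_on_sum:
  assumes "open S" "\<And>i. i \<in> I \<Longrightarrow> Ck_on k S (f i)"
  shows "Ck_on k S (\<lambda>x. \<Sum>i\<in>I. f i x)"
  using assms by (induction I rule: infinite_finite_induct) (auto intro: Ck_on_const Ck_on_add)

lemma (in bounded_linear) Ck_on:
  assumes "open S" "Ck_on k S g"
  shows "Ck_on k S (\<lambda>x. f (g x))"
  using assms(2)
proof (induction k arbitrary: g)
  case 0
  then show ?case by (simp add: continuous_on)
next
  case (Suc k)
  show ?case
    by (rule Ck_on_SucI[OF \<open>open S\<close> has_derivative[OF Ck_on_Suc_has_derivative[OF Suc.prems]]])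
      (auto intro!: Suc.IH simp: Ck_on_Suc_frechet[OF Suc.prems])
qed

lemma (in bounded_bilinear) Ck_on:
  assumes "open S" "Ck_on k S f" "Ck_on k S g"
  shows "Ck_on k S (\<lambda>x. prod (f x) (g x))"
  using assms(2,3)
proof (induction k arbitrary: f g)
  case 0
  then show ?case by (simp add: continuous_on)
next
  case (Suc k)
  show ?case
    by (rule Ck_on_SucI[OF \<open>open S\<close> FDERIV[OF Ck_on_Suc_has_derivative[OF Suc.prems(1)] Ck_on_Suc_has_derivative[OF Suc.prems(2)]]])
      (auto intro!: Ck_on_add \<open>open S\<close> Suc.IH
        simp: Ck_on_Suc_frechet[OF Suc.prems(1)] Ck_on_Suc_frechet[OF Suc.prems(2)] Ck_on_SucD[OF Suc.prems(1)] Ck_on_SucD[OF Suc.prems(2)])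
qed

lemma Ck_on_Pair:
  assumes "open S" "Ck_on k S f" "Ck_on k S g"
  shows "Ck_on k S (\<lambda>x. (f x, g x))"
proof -
  have "bounded_linear (\<lambda>x::'b. (x, 0::'c))" "bounded_linear (\<lambda>y::'c. (0::'b, y))"
    by (auto intro!: bounded_linear_Pair bounded_linear_ident bounded_linear_zero)
  then have "Ck_on k S (\<lambda>x. (f x, 0::'c) + (0::'b, g x))"
    by (intro Ck_on_add assms bounded_linear.Ck_on[of "\<lambda>x. (x, 0)" S k f]
        bounded_linear.Ck_on[of "\<lambda>x. (0, x)" S k g])
  then show ?thesis by simp
qed

section \<open>Orthonormal expansions and compositions in the model spaces\<close>

lemma fin_euclidean_expansion:
  obtains B :: "'a::fin_euclidean set" where "finite B" "\<forall>x. x = (\<Sum>u\<in>B. (x \<bullet> u) *\<^sub>R u)"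
proof -
  obtain B :: "'a set" where B: "finite B" "\<And>u v. u \<in> B \<Longrightarrow> v \<in> B \<Longrightarrow> u \<bullet> v = (if u = v then 1 else 0)"
    "\<And>x. (\<forall>u\<in>B. x \<bullet> u = 0) \<Longrightarrow> x = 0"
    using finite_orthonormal_basis by metis
  have "x = (\<Sum>u\<in>B. (x \<bullet> u) *\<^sub>R u)" for x
  proof -
    \<comment> \<open>The remainder of the expansion is orthogonal to \<open>B\<close>, which forces
      it to be 0.\<close>
    have "(x - (\<Sum>u\<in>B. (x \<bullet> u) *\<^sub>R u)) \<bullet> w = 0" if "w \<in> B" for w
    proof -
      have "(\<Sum>u\<in>B. (x \<bullet> u) * (u \<bullet> w)) = (\<Sum>u\<in>B. if u = w then x \<bullet> w else 0)"
        using B(2) that by (intro sum.cong) auto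
      then show ?thesis
        using B(1) that by (simp add: inner_diff_left inner_sum_left)
    qed
    then show ?thesis using B(3) by fastforce
  qed
  then show thesis by (intro that[OF B(1)] allI)
qed

text \<open>Bundle charts take values in \<open>'e \<times> 'f\<close>, and this product occurs as
  the middle space of a composition, where a finite basis is required.\<close>

instance prod :: (fin_euclidean, fin_euclidean) fin_euclidean
proof
  obtain B :: "'a set" where B: "finite B" "\<forall>u\<in>B. \<forall>v\<in>B. u \<bullet> v = (if u = v then 1 else 0)"
    "\<forall>x. (\<forall>u\<in>B. x \<bullet> u = 0) \<longrightarrow> x = 0"
    using finite_orthonormal_basis by metis
  obtain D :: "'b set" where D: "finite D" "\<forall>u\<in>D. \<forall>v\<in>D. u \<bullet> v = (if u = v then 1 else 0)"
    "\<forall>x. (\<forall>u\<in>D. x \<bullet> u = 0) \<longrightarrow> x = 0"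
    using finite_orthonormal_basis by metis
  \<comment> \<open>The vectors (u, 0) and (0, v) could coincide only at 0. Excluding 0 keeps them
    distinct, as their inner product 0 demands.\<close>
  have nz: "0 \<notin> B" "0 \<notin> D" using B(2) D(2) by force+
  show "\<exists>C::('a \<times> 'b) set. finite C \<and> (\<forall>u\<in>C. \<forall>v\<in>C. u \<bullet> v = (if u = v then 1 else 0)) \<and>
         (\<forall>x. (\<forall>u\<in>C. x \<bullet> u = 0) \<longrightarrow> x = 0)"
  proof (intro exI conjI)
    show "finite ((\<lambda>u. (u, 0)) ` B \<union> (\<lambda>v. (0, v)) ` D)" using B(1) D(1) by simp
    show "\<forall>u\<in>(\<lambda>u. (u, 0)) ` B \<union> (\<lambda>v. (0, v)) ` D. \<forall>v\<in>(\<lambda>u. (u, 0)) ` B \<union> (\<lambda>v. (0, v)) ` D.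
        u \<bullet> v = (if u = v then 1 else 0)"
      using nz by (auto simp: inner_prod_def B(2)[rule_format] D(2)[rule_format] split: if_splits)
    show "\<forall>x. (\<forall>u\<in>(\<lambda>u. (u, 0)) ` B \<union> (\<lambda>v. (0, v)) ` D. x \<bullet> u = 0) \<longrightarrow> x = 0"
    proof (intro allI impI)
      fix x :: "'a \<times> 'b"
      assume a: "\<forall>u\<in>(\<lambda>u. (u, 0)) ` B \<union> (\<lambda>v. (0, v)) ` D. x \<bullet> u = 0"
      have "\<forall>u\<in>B. fst x \<bullet> u = 0" "\<forall>u\<in>D. snd x \<bullet> u = 0"
        using a by (auto simp: inner_prod_def ball_Un)
      then have "fst x = 0" "snd x = 0"
        using B(3) D(3) by blast+
      then show "x = 0" by (simp add: prod_eq_iff)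
    qed
  qed
qed

lemma linear_basis_expansion:
  assumes "linear L" "\<forall>x. x = (\<Sum>u\<in>B. (x \<bullet> u) *\<^sub>R u)"
  shows "L x = (\<Sum>u\<in>B. (x \<bullet> u) *\<^sub>R L u)"
  using assms(1) by (subst assms(2)[rule_format, of x]) (simp add: linear_sum linear_scale)

text \<open>\<open>Ck_on\<close> controls derivatives in constant directions only. Expanding the
  varying direction in an orthonormal basis leaves finitely many of these, with coefficients as
  regular as \<open>a\<close>.\<close>

lemma Ck_on_frechet_apply:
  fixes f :: "'a::fin_euclidean \<Rightarrow> 'b::real_normed_vector"
  assumes "open S" "Ck_on (Suc k) S f" "Ck_on k S a"
  shows "Ck_on k S (\<lambda>x. frechet_derivative f (at x) (a x))"
proof -
  obtain B :: "'a set" where B: "finite B" "\<forall>x. x = (\<Sum>u\<in>B. (x \<bullet> u) *\<^sub>R u)"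
    by (rule fin_euclidean_expansion)
  have "Ck_on k S (\<lambda>x. \<Sum>u\<in>B. (a x \<bullet> u) *\<^sub>R frechet_derivative f (at x) u)"
    using assms
    by (intro Ck_on_sum bounded_bilinear.Ck_on[OF bounded_bilinear_scaleR]
        bounded_linear.Ck_on[OF bounded_linear_inner_left]) auto
  moreover have "(\<Sum>u\<in>B. (a x \<bullet> u) *\<^sub>R frechet_derivative f (at x) u) = frechet_derivative f (at x) (a x)"
    if "x \<in> S" for x
    by (rule linear_basis_expansion[OF has_derivative_linear[OF Ck_on_Suc_has_derivative[OF assms(2) that]]
          B(2), symmetric])
  ultimately show ?thesis
    by (rule Ck_on_cong[OF \<open>open S\<close>, rotated])
qed

lemma Ck_on_compose:
  fixes f :: "'a::real_normed_vector \<Rightarrow> 'b::fin_euclidean"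
  assumes "open S" "open T" "f ` S \<subseteq> T" "Ck_on k S f" "Ck_on k T g"
  shows "Ck_on k S (g \<circ> f)"
  using assms(4,5)
proof (induction k arbitrary: g)
  case 0
  then show ?case
    using assms(3) by (metis Ck_on.simps(1) continuous_on_compose continuous_on_subset)
next
  case (Suc k)
  obtain B :: "'b set" where B: "finite B" "\<forall>x. x = (\<Sum>u\<in>B. (x \<bullet> u) *\<^sub>R u)"
    by (rule fin_euclidean_expansion)
  \<comment> \<open>The chain rule feeds a varying vector into the derivative of \<open>g\<close>.
    After expansion in the basis, each factor is a composition with \<open>f\<close> of a derivative
    of \<open>g\<close> in a constant direction, to which the induction hypothesis applies.\<close>
  have d: "(g \<circ> f has_derivative (\<lambda>v. \<Sum>u\<in>B. (frechet_derivative f (at x) v \<bullet> u) *\<^sub>R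
      frechet_derivative g (at (f x)) u)) (at x)" if "x \<in> S" for x
  proof -
    have "f x \<in> T" using that assms(3) by blast
    then have g: "(g has_derivative frechet_derivative g (at (f x))) (at (f x))"
      using Suc.prems(2) Ck_on_Suc_has_derivative by blast
    have "(g \<circ> f has_derivative frechet_derivative g (at (f x)) \<circ> frechet_derivative f (at x)) (at x)"
      by (intro diff_chain_at Ck_on_Suc_has_derivative[OF Suc.prems(1) that] g)
    moreover have "frechet_derivative g (at (f x)) \<circ> frechet_derivative f (at x)
        = (\<lambda>v. \<Sum>u\<in>B. (frechet_derivative f (at x) v \<bullet> u) *\<^sub>R frechet_derivative g (at (f x)) u)"
      unfolding comp_def by (intro ext linear_basis_expansion[OF has_derivative_linear[OF g] B(2)])
    ultimately show ?thesis by (simp only:)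
  qed
  have "Ck_on k S (\<lambda>x. frechet_derivative g (at (f x)) u)" for u
    using Suc.IH[OF Ck_on_SucD[OF Suc.prems(1)] Ck_on_Suc_frechet[OF Suc.prems(2)]]
    by (simp add: comp_def)
  then have "Ck_on k S (\<lambda>x. \<Sum>u\<in>B. (frechet_derivative f (at x) v \<bullet> u) *\<^sub>R
      frechet_derivative g (at (f x)) u)" for v
    by (intro Ck_on_sum bounded_bilinear.Ck_on[OF bounded_bilinear_scaleR]
        bounded_linear.Ck_on[OF bounded_linear_inner_left] Ck_on_Suc_frechet[OF Suc.prems(1)]
        \<open>open S\<close>)
  with d show ?case
    by (rule Ck_on_SucI[OF \<open>open S\<close>])
qed

lemma smooth_on_imp_differentiable: "smooth_on S f \<Longrightarrow> x \<in> S \<Longrightarrow> f differentiable at x"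
  unfolding smooth_on_def by (metis Ck_on.simps(2))

lemma smooth_on_cong:
  "open S \<Longrightarrow> (\<And>x. x \<in> S \<Longrightarrow> f x = g x) \<Longrightarrow> smooth_on S f \<Longrightarrow> smooth_on S g"
  unfolding smooth_on_def using Ck_on_cong by blast

lemma smooth_on_subset: "smooth_on T f \<Longrightarrow> S \<subseteq> T \<Longrightarrow> smooth_on S f"
  unfolding smooth_on_def using Ck_on_subset by blast

lemma smooth_on_local:
  "(\<And>x. x \<in> S \<Longrightarrow> \<exists>T. open T \<and> x \<in> T \<and> smooth_on T f) \<Longrightarrow> smooth_on S f"
  unfolding smooth_on_def by (intro allI Ck_on_local) blast

lemma smooth_on_const: "smooth_on S (\<lambda>x. c)"
  by (simp add: smooth_on_def Ck_on_const)

lemma smooth_on_add: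
  "open S \<Longrightarrow> smooth_on S f \<Longrightarrow> smooth_on S g \<Longrightarrow> smooth_on S (\<lambda>x. f x + g x)"
  by (simp add: smooth_on_def Ck_on_add)

lemma smooth_on_scaleR:
  "open S \<Longrightarrow> smooth_on S f \<Longrightarrow> smooth_on S g \<Longrightarrow> smooth_on S (\<lambda>x. f x *\<^sub>R g x)"
  by (simp add: smooth_on_def bounded_bilinear.Ck_on[OF bounded_bilinear_scaleR])

lemma smooth_on_Pair:
  "open S \<Longrightarrow> smooth_on S f \<Longrightarrow> smooth_on S g \<Longrightarrow> smooth_on S (\<lambda>x. (f x, g x))"
  by (simp add: smooth_on_def Ck_on_Pair)

lemma smooth_on_snd: "open S \<Longrightarrow> smooth_on S f \<Longrightarrow> smooth_on S (\<lambda>x. snd (f x))"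
  by (simp add: smooth_on_def bounded_linear.Ck_on[OF bounded_linear_snd])

lemma smooth_on_compose:
  fixes f :: "'a::real_normed_vector \<Rightarrow> 'b::fin_euclidean"
  shows "open S \<Longrightarrow> open T \<Longrightarrow> f ` S \<subseteq> T \<Longrightarrow> smooth_on S f \<Longrightarrow> smooth_on T g \<Longrightarrow> smooth_on S (g \<circ> f)"
  by (simp add: smooth_on_def Ck_on_compose)

lemma smooth_on_frechet_apply:
  fixes f :: "'a::fin_euclidean \<Rightarrow> 'b::real_normed_vector"
  shows "open S \<Longrightarrow> smooth_on S f \<Longrightarrow> smooth_on S a \<Longrightarrow>
    smooth_on S (\<lambda>x. frechet_derivative f (at x) (a x))"
  unfolding smooth_on_def using Ck_on_frechet_apply by blast

section \<open>Smooth functions and sections\<close>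

locale algebroid =
  fixes G :: "('m::{t2_space,second_countable_topology}, 'e::fin_euclidean, 'v, 'f::fin_euclidean)
                lie_algebroid_data"
  assumes lie_algebroid_G: "lie_algebroid G"
begin

abbreviation "At \<equiv> base_atlas G"
abbreviation "C \<equiv> smooth_functions (base_atlas G)"

lemma is_bundle: "vector_bundle G" and brackets: "lie_bracket_on_sections G"
  and anchor_map: "anchor_bundle_map G"
  and bracket_Leibniz: "s \<in> A1 G \<Longrightarrow> t \<in> A1 G \<Longrightarrow> f \<in> C \<Longrightarrow>
        bracket G s (smult G f t) = sadd G (smult G f (bracket G s t)) (smult G (lie_fun G s f) t)"
  using lie_algebroid_G by (auto simp: lie_algebroid_def)

lemma manifold: "smooth_manifold At"
  using is_bundle by (simp add: vector_bundle_def)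

lemma
  assumes "(U, \<phi>) \<in> At"
  shows open_chart: "open U" and open_chart_image: "open (\<phi> ` U)"
    and chart_homeomorphism: "homeomorphism U (\<phi> ` U) \<phi> (inv_into U \<phi>)"
  using manifold assms by (auto simp: smooth_manifold_def)

lemma chart_inv [simp]: "(U, \<phi>) \<in> At \<Longrightarrow> x \<in> U \<Longrightarrow> inv_into U \<phi> (\<phi> x) = x"
  using chart_homeomorphism by (auto simp: homeomorphism_def)

lemma open_chart_Int:
  assumes "(U, \<phi>) \<in> At" "open W"
  shows "open (\<phi> ` (U \<inter> W))"
proof -
  have "openin (top_of_set (\<phi> ` U)) (\<phi> ` (U \<inter> W))"
    using assms by (intro homeomorphism_imp_open_map[OF chart_homeomorphism]) auto
  then show ?thesis
    using open_chart_image[OF assms(1)] by (metis openin_open_eq)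
qed

lemma chart_cover: obtains U \<phi> where "(U, \<phi>) \<in> At" "x \<in> U"
proof -
  have "x \<in> \<Union>(fst ` At)" using manifold by (simp add: smooth_manifold_def)
  then show thesis using that by force
qed

lemma transition_smooth:
  "(U, \<phi>) \<in> At \<Longrightarrow> (W, \<psi>) \<in> At \<Longrightarrow> smooth_on (\<phi> ` (U \<inter> W)) (\<psi> \<circ> inv_into U \<phi>)"
  using manifold by (auto simp: smooth_manifold_def smooth_compatible_def)

lemma C_iff: "f \<in> C \<longleftrightarrow> (\<forall>(U, \<phi>)\<in>At. smooth_on (\<phi> ` U) (\<lambda>y. f (inv_into U \<phi> y)))"
  using open_chart_image
  by (auto simp: smooth_functions_def smooth_map_def comp_def cong: ball_cong)

lemma C_smooth: "f \<in> C \<Longrightarrow> (U, \<phi>) \<in> At \<Longrightarrow> smooth_on (\<phi> ` U) (\<lambda>y. f (inv_into U \<phi> y))"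
  by (auto simp: C_iff)

lemma C_const: "(\<lambda>x. c) \<in> C"
  by (auto simp: C_iff smooth_on_const)

lemma C_add: "f \<in> C \<Longrightarrow> g \<in> C \<Longrightarrow> f + g \<in> C"
  by (auto simp: C_iff intro!: smooth_on_add open_chart_image)

lemma C_mult: "f \<in> C \<Longrightarrow> g \<in> C \<Longrightarrow> f * g \<in> C"
  using smooth_on_scaleR[where 'b=real] open_chart_image by (force simp: C_iff)

section \<open>Sections of the bundle in local trivializations\<close>

lemma trivialization_cover: obtains W \<psi> where "(W, \<psi>) \<in> trivializations G" "x \<in> W"
proof -
  have "x \<in> \<Union>(fst ` trivializations G)" using is_bundle by (simp add: vector_bundle_def)
  then show thesis using that by force
qed

lemma open_trivialization: "(W, \<psi>) \<in> trivializations G \<Longrightarrow> open W"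
  using is_bundle by (auto simp: vector_bundle_def)

lemma trivialization_fibre:
  assumes "(W, \<psi>) \<in> trivializations G" "x \<in> W"
  shows "inj_on \<psi> (fibre G x)" "\<psi> ` fibre G x = UNIV"
    and "v \<in> fibre G x \<Longrightarrow> w \<in> fibre G x \<Longrightarrow> \<psi> (vadd G v w) = \<psi> v + \<psi> w"
    and "v \<in> fibre G x \<Longrightarrow> \<psi> (vscale G c v) = c *\<^sub>R \<psi> v"
proof -
  from is_bundle have "\<forall>(W, \<psi>)\<in>trivializations G. open W \<and>
        (\<forall>x\<in>W. bij_betw \<psi> (fibre G x) UNIV \<and>
           (\<forall>v\<in>fibre G x. \<forall>w\<in>fibre G x. \<psi> (vadd G v w) = \<psi> v + \<psi> w) \<and>
           (\<forall>v\<in>fibre G x. \<forall>c. \<psi> (vscale G c v) = c *\<^sub>R \<psi> v))"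
    unfolding vector_bundle_def by (elim conjE)
  from bspec[OF this assms(1)] assms(2) have *: "bij_betw \<psi> (fibre G x) UNIV"
    "\<forall>v\<in>fibre G x. \<forall>w\<in>fibre G x. \<psi> (vadd G v w) = \<psi> v + \<psi> w"
    "\<forall>v\<in>fibre G x. \<forall>c. \<psi> (vscale G c v) = c *\<^sub>R \<psi> v"
    by simp_all
  from * show "inj_on \<psi> (fibre G x)" "\<psi> ` fibre G x = UNIV"
    and "v \<in> fibre G x \<Longrightarrow> w \<in> fibre G x \<Longrightarrow> \<psi> (vadd G v w) = \<psi> v + \<psi> w"
    and "v \<in> fibre G x \<Longrightarrow> \<psi> (vscale G c v) = c *\<^sub>R \<psi> v"
    by (simp_all add: bij_betw_def)
qed

lemma A1_proj: "V \<in> A1 G \<Longrightarrow> proj G (V x) = x"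
  by (simp add: A1_def)

lemma A1_fibre: "V \<in> A1 G \<Longrightarrow> V x \<in> fibre G x"
  by (simp add: A1_proj fibre_def)

lemma A1_chart_smooth:
  assumes "V \<in> A1 G" "(U, \<phi>) \<in> At" "(U', \<phi>') \<in> At" "(W, \<psi>) \<in> trivializations G"
  shows "smooth_on (\<phi> ` (U \<inter> (U' \<inter> W))) (\<lambda>y. (\<phi>' (inv_into U \<phi> y), \<psi> (V (inv_into U \<phi> y))))"
proof -
  let ?c = "({v. proj G v \<in> U' \<inter> W}, \<lambda>v. (\<phi>' (proj G v), \<psi> v))"
  have "?c \<in> total_atlas G"
    using assms unfolding total_atlas_def by blast
  moreover have "smooth_map At (total_atlas G) V"
    using assms(1) by (simp add: A1_def)
  ultimately have "smooth_on (\<phi> ` (U \<inter> V -` fst ?c)) (snd ?c \<circ> V \<circ> inv_into U \<phi>)"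
    using assms(2) unfolding smooth_map_def by fastforce
  then show ?thesis
    using A1_proj[OF assms(1)] by (simp add: comp_def vimage_def Int_def)
qed

lemma A1_smooth:
  assumes "V \<in> A1 G" "(U, \<phi>) \<in> At" "(W, \<psi>) \<in> trivializations G"
  shows "smooth_on (\<phi> ` (U \<inter> W)) (\<lambda>y. \<psi> (V (inv_into U \<phi> y)))"
  using smooth_on_snd[OF _ A1_chart_smooth[OF assms(1,2,2,3)]] open_chart_Int[OF assms(2)]
    open_trivialization[OF assms(3)] by simp

text \<open>In bundle charts the base component of a section is a change of charts of the manifold,
  hence smooth; only the fibre component is left to check.\<close>

lemma A1I:
  assumes "\<And>x. proj G (V x) = x"
    and "\<And>U \<phi> W \<psi>. (U, \<phi>) \<in> At \<Longrightarrow> (W, \<psi>) \<in> trivializations G \<Longrightarrow>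
      smooth_on (\<phi> ` (U \<inter> W)) (\<lambda>y. \<psi> (V (inv_into U \<phi> y)))"
  shows "V \<in> A1 G"
proof -
  have "open (\<phi> ` (U \<inter> (U' \<inter> W)))"
    "smooth_on (\<phi> ` (U \<inter> (U' \<inter> W))) (\<lambda>y. (\<phi>' (inv_into U \<phi> y), \<psi> (V (inv_into U \<phi> y))))"
    if c: "(U, \<phi>) \<in> At" "(U', \<phi>') \<in> At" "(W, \<psi>) \<in> trivializations G" for U \<phi> U' \<phi>' W \<psi>
  proof -
    show o: "open (\<phi> ` (U \<inter> (U' \<inter> W)))"
      by (intro open_chart_Int[OF c(1)] open_Int open_chart[OF c(2)] open_trivialization[OF c(3)])
    have "smooth_on (\<phi> ` (U \<inter> (U' \<inter> W))) (\<lambda>y. \<phi>' (inv_into U \<phi> y))"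
      using transition_smooth[OF c(1,2)] by (auto simp: comp_def intro: smooth_on_subset)
    moreover have "smooth_on (\<phi> ` (U \<inter> (U' \<inter> W))) (\<lambda>y. \<psi> (V (inv_into U \<phi> y)))"
      using assms(2)[OF c(1,3)] by (auto intro: smooth_on_subset)
    ultimately show "smooth_on (\<phi> ` (U \<inter> (U' \<inter> W)))
        (\<lambda>y. (\<phi>' (inv_into U \<phi> y), \<psi> (V (inv_into U \<phi> y))))"
      by (intro smooth_on_Pair o)
  qed
  moreover have "V x \<in> \<Union>(fst ` total_atlas G)" for x
  proof -
    obtain U \<phi> where U: "(U, \<phi>) \<in> At" "x \<in> U" by (rule chart_cover)
    obtain W \<psi> where W: "(W, \<psi>) \<in> trivializations G" "x \<in> W" by (rule trivialization_cover)
    have "({v. proj G v \<in> U \<inter> W}, \<lambda>v. (\<phi> (proj G v), \<psi> v)) \<in> total_atlas G"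
      using U W unfolding total_atlas_def by blast
    moreover have "V x \<in> fst ({v. proj G v \<in> U \<inter> W}, \<lambda>v. (\<phi> (proj G v), \<psi> v))"
      using U W assms(1) by simp
    ultimately show ?thesis by blast
  qed
  ultimately have "smooth_map At (total_atlas G) V"
    unfolding smooth_map_def by (auto simp: total_atlas_def comp_def vimage_def assms(1) Collect_conj_eq)
  then show ?thesis
    using assms(1) by (simp add: A1_def)
qed

lemma sadd_closed:
  assumes "V \<in> A1 G" "W \<in> A1 G"
  shows "sadd G V W \<in> A1 G"
proof (rule A1I)
  show "proj G (sadd G V W x) = x" for x
    using is_bundle A1_fibre assms by (fastforce simp: vector_bundle_def sadd_def fibre_def)
next
  fix U \<phi> T \<psi> assume c: "(U, \<phi>) \<in> At" "(T, \<psi>) \<in> trivializations G"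
  have o: "open (\<phi> ` (U \<inter> T))" by (rule open_chart_Int[OF c(1) open_trivialization[OF c(2)]])
  show "smooth_on (\<phi> ` (U \<inter> T)) (\<lambda>y. \<psi> (sadd G V W (inv_into U \<phi> y)))"
    by (rule smooth_on_cong[OF o _ smooth_on_add[OF o A1_smooth[OF assms(1) c] A1_smooth[OF assms(2) c]]])
      (use c trivialization_fibre(3)[OF c(2)] A1_fibre assms in \<open>auto simp: sadd_def\<close>)
qed

lemma smult_closed:
  assumes "f \<in> C" "V \<in> A1 G"
  shows "smult G f V \<in> A1 G"
proof (rule A1I)
  show "proj G (smult G f V x) = x" for x
    using is_bundle A1_fibre assms by (fastforce simp: vector_bundle_def smult_def fibre_def)
next
  fix U \<phi> T \<psi> assume c: "(U, \<phi>) \<in> At" "(T, \<psi>) \<in> trivializations G"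
  have o: "open (\<phi> ` (U \<inter> T))" by (rule open_chart_Int[OF c(1) open_trivialization[OF c(2)]])
  have "smooth_on (\<phi> ` (U \<inter> T)) (\<lambda>y. f (inv_into U \<phi> y))"
    using C_smooth[OF assms(1) c(1)] by (rule smooth_on_subset) auto
  from smooth_on_scaleR[OF o this A1_smooth[OF assms(2) c]]
  show "smooth_on (\<phi> ` (U \<inter> T)) (\<lambda>y. \<psi> (smult G f V (inv_into U \<phi> y)))"
    by (rule smooth_on_cong[OF o, rotated])
      (use c trivialization_fibre(4)[OF c(2)] A1_fibre assms in \<open>auto simp: smult_def\<close>)
qed

lemma bracket_closed: "V \<in> A1 G \<Longrightarrow> W \<in> A1 G \<Longrightarrow> bracket G V W \<in> A1 G"
  using brackets by (simp add: lie_bracket_on_sections_def)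

text \<open>The fibre coordinate of a section in an arbitrary trivialization turns identities between
  sections into identities of vectors.\<close>

definition coord :: "('m, 'v) sect \<Rightarrow> 'm \<Rightarrow> 'f" where
  "coord V x = snd (SOME c. c \<in> trivializations G \<and> x \<in> fst c) (V x)"

lemma coord_trivialization:
  obtains W \<psi> where "(W, \<psi>) \<in> trivializations G" "x \<in> W" "\<And>V. coord V x = \<psi> (V x)"
proof -
  obtain W \<psi> where c: "(SOME c. c \<in> trivializations G \<and> x \<in> fst c) = (W, \<psi>)" by force
  obtain W' \<psi>' where "(W', \<psi>') \<in> trivializations G" "x \<in> W'" by (rule trivialization_cover)
  then have "\<exists>c. c \<in> trivializations G \<and> x \<in> fst c" by force
  from someI_ex[OF this] show thesis
    unfolding c by (intro that[of W \<psi>]) (simp_all add: coord_def c)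
qed

lemma coord_sadd: "V \<in> A1 G \<Longrightarrow> W \<in> A1 G \<Longrightarrow> coord (sadd G V W) x = coord V x + coord W x"
  by (rule coord_trivialization[of x]) (simp add: sadd_def trivialization_fibre A1_fibre)

lemma coord_smult: "V \<in> A1 G \<Longrightarrow> coord (smult G f V) x = f x *\<^sub>R coord V x"
  by (rule coord_trivialization[of x]) (simp add: smult_def trivialization_fibre A1_fibre)

lemma fibre_eqI:
  "V x \<in> fibre G x \<Longrightarrow> W x \<in> fibre G x \<Longrightarrow> coord V x = coord W x \<Longrightarrow> V x = W x"
  by (rule coord_trivialization[of x]) (metis inj_onD trivialization_fibre(1))

lemma section_eqI:
  "V \<in> A1 G \<Longrightarrow> W \<in> A1 G \<Longrightarrow> (\<And>x. coord V x = coord W x) \<Longrightarrow> V = W"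
  by (auto intro: fibre_eqI A1_fibre)

text \<open>\<open>szero\<close> is a definite description of a neutral element of the fibre. The
  vector that \<open>\<psi>\<close> sends to 0 satisfies it, and cancellation in \<open>'f\<close>
  makes it unique.\<close>

lemma coord_szero: "coord (szero G) x = 0"
proof (rule coord_trivialization[of x])
  fix W \<psi> assume W: "(W, \<psi>) \<in> trivializations G" "x \<in> W" and c: "\<And>V. coord V x = \<psi> (V x)"
  note tr = trivialization_fibre[OF W]
  obtain z where z: "z \<in> fibre G x" "\<psi> z = 0" using tr(2) by (metis UNIV_I imageE)
  have cl: "vadd G v w \<in> fibre G x" if "v \<in> fibre G x" "w \<in> fibre G x" for v w
    using is_bundle that by (auto simp: vector_bundle_def)
  have "szero G x = z" unfolding szero_def
  proof (rule the_equality)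
    show "z \<in> fibre G x \<and> (\<forall>v\<in>fibre G x. vadd G z v = v)"
      using z cl tr(1,3) by (auto simp: inj_on_def)
    fix z' assume z': "z' \<in> fibre G x \<and> (\<forall>v\<in>fibre G x. vadd G z' v = v)"
    then have "\<psi> z' + \<psi> z = \<psi> z" using tr(3) z by metis
    then show "z' = z" using tr(1) z z' by (auto simp: inj_on_def)
  qed
  then show ?thesis using c z by simp
qed

end

section \<open>The Lie derivative of functions\<close>

context algebroid
begin

abbreviation "L \<equiv> lie_fun G"
abbreviation "anchor_vec V x c \<equiv> snd (anchor G ((V :: ('m, 'v) sect) x)) c"

lemma anchor_smooth: "smooth_map (total_atlas G) (tangent_atlas At) (anchor G)"
  and fst_anchor: "fst (anchor G v) = proj G v"
  and anchor_sadd: "v \<in> fibre G x \<Longrightarrow> w \<in> fibre G x \<Longrightarrow>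
    snd (anchor G (vadd G v w)) c = snd (anchor G v) c + snd (anchor G w) c"
  and anchor_smult: "snd (anchor G (vscale G a v)) c = a *\<^sub>R snd (anchor G v) c"
  using anchor_map by (auto simp: anchor_bundle_map_def)

text \<open>Tangency is part of smoothness of the anchor: \<open>smooth_map\<close> requires its
  values to lie in the domains of the tangent charts.\<close>

lemma anchor_tangent:
  assumes "V \<in> A1 G"
  shows "snd (anchor G (V x)) \<in> tangent_space At x"
proof -
  obtain U \<phi> where U: "(U, \<phi>) \<in> At" "x \<in> U" by (rule chart_cover)
  obtain W \<psi> where W: "(W, \<psi>) \<in> trivializations G" "x \<in> W" by (rule trivialization_cover)
  have "({v. proj G v \<in> U \<inter> W}, \<lambda>v. (\<phi> (proj G v), \<psi> v)) \<in> total_atlas G"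
    using U W unfolding total_atlas_def by blast
  then have "anchor G ` {v. proj G v \<in> U \<inter> W} \<subseteq> \<Union>(fst ` tangent_atlas At)"
    using anchor_smooth unfolding smooth_map_def by fastforce
  then have "anchor G (V x) \<in> \<Union>(fst ` tangent_atlas At)"
    by (rule subsetD) (use A1_proj[OF assms] U W in simp)
  moreover have "fst (anchor G (V x)) = x"
    using fst_anchor A1_proj[OF assms] by simp
  ultimately show ?thesis
    by (auto simp: tangent_atlas_def)
qed

lemma C_differentiable:
  assumes "f \<in> C" "(U, \<phi>) \<in> At" "x \<in> U"
  shows "(f \<circ> inv_into U \<phi>) differentiable at (\<phi> x)"
  using smooth_on_imp_differentiable[OF C_smooth[OF assms(1,2)]] assms(3) by (auto simp: comp_def)

text \<open>The chain rule for the change from \<open>U\<close> to the chart picked by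
  \<open>SOME\<close> matches the transformation rule in \<open>tangent_space\<close>.\<close>

lemma tangent_apply_chart:
  assumes "v \<in> tangent_space At x" "f \<in> C" "(U, \<phi>) \<in> At" "x \<in> U"
  shows "tangent_apply At (x, v) f = frechet_derivative (f \<circ> inv_into U \<phi>) (at (\<phi> x)) (v (U, \<phi>))"
proof -
  obtain W \<psi> where c: "(SOME c. c \<in> At \<and> x \<in> fst c) = (W, \<psi>)" by force
  have "\<exists>c. c \<in> At \<and> x \<in> fst c" using assms by force
  from someI_ex[OF this] have W: "(W, \<psi>) \<in> At" "x \<in> W" unfolding c by auto
  let ?t = "\<psi> \<circ> inv_into U \<phi>"
  have ov: "open (\<phi> ` (U \<inter> W))" by (rule open_chart_Int[OF assms(3) open_chart[OF W(1)]])
  have dt: "?t differentiable at (\<phi> x)"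
    by (rule smooth_on_imp_differentiable[OF transition_smooth[OF assms(3) W(1)]]) (use assms W in auto)
  have tx: "?t (\<phi> x) = \<psi> x" using assms by simp
  have df: "(f \<circ> inv_into W \<psi>) differentiable at (\<psi> x)"
    by (rule C_differentiable[OF assms(2) W])
  have "((f \<circ> inv_into W \<psi>) \<circ> ?t has_derivative
      frechet_derivative (f \<circ> inv_into W \<psi>) (at (\<psi> x)) \<circ> frechet_derivative ?t (at (\<phi> x))) (at (\<phi> x))"
    using has_derivative_frechet[OF df] has_derivative_frechet[OF dt]
    by (intro diff_chain_at) (simp_all only: tx)
  then have "(f \<circ> inv_into U \<phi> has_derivative
      frechet_derivative (f \<circ> inv_into W \<psi>) (at (\<psi> x)) \<circ> frechet_derivative ?t (at (\<phi> x))) (at (\<phi> x))"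
    by (rule has_derivative_transform_within_open[OF _ ov]) (use assms W in auto)
  then have "frechet_derivative (f \<circ> inv_into U \<phi>) (at (\<phi> x)) =
      frechet_derivative (f \<circ> inv_into W \<psi>) (at (\<psi> x)) \<circ> frechet_derivative ?t (at (\<phi> x))"
    by (rule frechet_derivative_eqI)
  moreover have "v (W, \<psi>) = frechet_derivative ?t (at (\<phi> x)) (v (U, \<phi>))"
    using assms W unfolding tangent_space_def by blast
  ultimately show ?thesis
    by (simp add: tangent_apply_def c)
qed

lemma lie_fun_chart:
  assumes "V \<in> A1 G" "f \<in> C" "(U, \<phi>) \<in> At" "x \<in> U"
  shows "L V f x = frechet_derivative (f \<circ> inv_into U \<phi>) (at (\<phi> x)) (anchor_vec V x (U, \<phi>))"
proof -
  have "anchor G (V x) = (x, snd (anchor G (V x)))"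
    using fst_anchor A1_proj[OF assms(1)] by (metis prod.collapse)
  then show ?thesis
    using tangent_apply_chart[OF anchor_tangent[OF assms(1)] assms(2-4)]
    by (simp add: lie_fun_def lie_derivative_def)
qed

text \<open>Locally, these coordinates are the section in bundle charts followed by the anchor
  between bundle charts and tangent charts.\<close>

lemma anchor_vec_smooth:
  assumes "V \<in> A1 G" "(U, \<phi>) \<in> At"
  shows "smooth_on (\<phi> ` U) (\<lambda>y. anchor_vec V (inv_into U \<phi> y) (U, \<phi>))"
proof (rule smooth_on_local)
  fix y assume "y \<in> \<phi> ` U"
  then obtain x where x: "x \<in> U" "y = \<phi> x" by blast
  obtain W \<psi> where W: "(W, \<psi>) \<in> trivializations G" "x \<in> W" by (rule trivialization_cover)
  define D where "D = {v. proj G v \<in> U \<inter> W}"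
  define \<Phi> where "\<Phi> = (\<lambda>v. (\<phi> (proj G v), \<psi> v))"
  define S where "S = \<phi> ` (U \<inter> W)"
  have "(D, \<Phi>) \<in> total_atlas G"
    using assms(2) W unfolding total_atlas_def D_def \<Phi>_def by blast
  moreover have "({(x, v). x \<in> U \<and> v \<in> tangent_space At x}, \<lambda>(x, v). (\<phi> x, v (U, \<phi>))) \<in> tangent_atlas At"
    using assms(2) unfolding tangent_atlas_def by force
  ultimately have anch: "open (\<Phi> ` (D \<inter> anchor G -` {(x, v). x \<in> U \<and> v \<in> tangent_space At x}))"
    "smooth_on (\<Phi> ` (D \<inter> anchor G -` {(x, v). x \<in> U \<and> v \<in> tangent_space At x}))
      ((\<lambda>(x, v). (\<phi> x, v (U, \<phi>))) \<circ> anchor G \<circ> inv_into D \<Phi>)"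
    using anchor_smooth unfolding smooth_map_def by fast+
  let ?T = "\<Phi> ` (D \<inter> anchor G -` {(x, v). x \<in> U \<and> v \<in> tangent_space At x})"
  have o: "open S" unfolding S_def by (rule open_chart_Int[OF assms(2) open_trivialization[OF W(1)]])
  \<comment> \<open>Smoothness of the anchor is stated for its composition with
    \<open>inv_into D \<Phi>\<close>. Injectivity cancels this against the bundle coordinates of the
    section.\<close>
  have inj: "inj_on \<Phi> D"
  proof (rule inj_onI)
    fix v w assume vw: "v \<in> D" "w \<in> D" "\<Phi> v = \<Phi> w"
    then have "proj G v = proj G w"
      unfolding D_def \<Phi>_def using chart_inv[OF assms(2)] by (metis IntD1 mem_Collect_eq prod.inject)
    then show "v = w"
      using vw trivialization_fibre(1)[OF W(1), of "proj G v"]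
      by (auto simp: D_def \<Phi>_def inj_on_def fibre_def)
  qed
  let ?V = "\<lambda>y. (\<phi> (inv_into U \<phi> y), \<psi> (V (inv_into U \<phi> y)))"
  have "smooth_on S ?V"
    using A1_chart_smooth[OF assms(1,2,2) W(1)] by (simp add: S_def)
  moreover have V: "?V y = \<Phi> (V (inv_into U \<phi> y))" "V (inv_into U \<phi> y) \<in> D" if "y \<in> S" for y
    using that assms(2) A1_proj[OF assms(1)] by (auto simp: S_def D_def \<Phi>_def)
  moreover have "anchor G (V (inv_into U \<phi> y)) \<in> {(x, v). x \<in> U \<and> v \<in> tangent_space At x}"
    if "y \<in> S" for y
    using that assms(2) anchor_tangent[OF assms(1)] fst_anchor A1_proj[OF assms(1)]
    by (auto simp: S_def case_prod_unfold)
  ultimately have "smooth_on S (((\<lambda>(x, v). (\<phi> x, v (U, \<phi>))) \<circ> anchor G \<circ> inv_into D \<Phi>) \<circ> ?V)"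
    by (intro smooth_on_compose[OF o anch(1) _ _ anch(2)]) (force simp del: mem_Collect_eq split_paired_All)+
  from smooth_on_snd[OF o this]
  have "smooth_on S (\<lambda>y. anchor_vec V (inv_into U \<phi> y) (U, \<phi>))"
    by (rule smooth_on_cong[OF o, rotated])
      (simp add: V(1) inv_into_f_f[OF inj V(2)] case_prod_unfold)
  then show "\<exists>T. open T \<and> y \<in> T \<and> smooth_on T (\<lambda>y. anchor_vec V (inv_into U \<phi> y) (U, \<phi>))"
    using o x W unfolding S_def by blast
qed

lemma lie_fun_closed:
  assumes "V \<in> A1 G" "f \<in> C"
  shows "L V f \<in> C"
  unfolding C_iff
proof clarify
  fix U \<phi> assume c: "(U, \<phi>) \<in> At"
  note o = open_chart_image[OF c]
  show "smooth_on (\<phi> ` U) (\<lambda>y. L V f (inv_into U \<phi> y))"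
    by (rule smooth_on_cong[OF o _
          smooth_on_frechet_apply[OF o C_smooth[OF assms(2) c] anchor_vec_smooth[OF assms(1) c]]])
      (use c assms in \<open>auto simp: lie_fun_chart comp_def\<close>)
qed

lemma lie_fun_const:
  assumes "V \<in> A1 G"
  shows "L V (\<lambda>x. c) = 0"
proof
  fix x
  obtain U \<phi> where U: "(U, \<phi>) \<in> At" "x \<in> U" by (rule chart_cover)
  show "L V (\<lambda>x. c) x = 0 x"
    by (subst lie_fun_chart[OF assms C_const U]) (simp add: comp_def)
qed

lemma lie_fun_add:
  assumes "V \<in> A1 G" "f \<in> C" "g \<in> C"
  shows "L V (f + g) = L V f + L V g"
proof
  fix x
  obtain U \<phi> where U: "(U, \<phi>) \<in> At" "x \<in> U" by (rule chart_cover)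
  have "((\<lambda>y. (f \<circ> inv_into U \<phi>) y + (g \<circ> inv_into U \<phi>) y) has_derivative
      (\<lambda>v. frechet_derivative (f \<circ> inv_into U \<phi>) (at (\<phi> x)) v +
           frechet_derivative (g \<circ> inv_into U \<phi>) (at (\<phi> x)) v)) (at (\<phi> x))"
    using assms U by (intro has_derivative_add has_derivative_frechet C_differentiable)
  from frechet_derivative_eqI[OF this] show "L V (f + g) x = (L V f + L V g) x"
    by (simp add: lie_fun_chart[OF assms(1) _ U] assms C_add comp_def)
qed

lemma lie_fun_mult:
  assumes "V \<in> A1 G" "f \<in> C" "g \<in> C"
  shows "L V (f * g) = f * L V g + L V f * g"
proof
  fix x
  obtain U \<phi> where U: "(U, \<phi>) \<in> At" "x \<in> U" by (rule chart_cover)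
  have "((\<lambda>y. (f \<circ> inv_into U \<phi>) y * (g \<circ> inv_into U \<phi>) y) has_derivative
      (\<lambda>v. (f \<circ> inv_into U \<phi>) (\<phi> x) * frechet_derivative (g \<circ> inv_into U \<phi>) (at (\<phi> x)) v +
           frechet_derivative (f \<circ> inv_into U \<phi>) (at (\<phi> x)) v * (g \<circ> inv_into U \<phi>) (\<phi> x))) (at (\<phi> x))"
    using assms U by (intro has_derivative_mult has_derivative_frechet C_differentiable)
  from frechet_derivative_eqI[OF this] show "L V (f * g) x = (f * L V g + L V f * g) x"
    using U by (simp add: lie_fun_chart[OF assms(1) _ U] assms C_mult comp_def)
qed

lemma lie_fun_sadd:
  assumes "V \<in> A1 G" "W \<in> A1 G" "f \<in> C"
  shows "L (sadd G V W) f = L V f + L W f"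
proof
  fix x
  obtain U \<phi> where U: "(U, \<phi>) \<in> At" "x \<in> U" by (rule chart_cover)
  have "linear (frechet_derivative (f \<circ> inv_into U \<phi>) (at (\<phi> x)))"
    by (intro linear_frechet_derivative C_differentiable assms U)
  moreover have "anchor_vec (sadd G V W) x c = anchor_vec V x c + anchor_vec W x c" for c
    using anchor_sadd[OF A1_fibre[OF assms(1)] A1_fibre[OF assms(2)]] by (simp add: sadd_def)
  ultimately show "L (sadd G V W) f x = (L V f + L W f) x"
    using assms by (simp add: lie_fun_chart[OF _ _ U] sadd_closed linear_add)
qed

lemma lie_fun_smult:
  assumes "V \<in> A1 G" "g \<in> C" "f \<in> C"
  shows "L (smult G g V) f = g * L V f"
proof
  fix x
  obtain U \<phi> where U: "(U, \<phi>) \<in> At" "x \<in> U" by (rule chart_cover)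
  have "linear (frechet_derivative (f \<circ> inv_into U \<phi>) (at (\<phi> x)))"
    by (intro linear_frechet_derivative C_differentiable assms U)
  moreover have "anchor_vec (smult G g V) x c = g x *\<^sub>R anchor_vec V x c" for c
    by (simp add: smult_def anchor_smult)
  ultimately show "L (smult G g V) f x = (g * L V f) x"
    using assms by (simp add: lie_fun_chart[OF _ _ U] smult_closed linear_scale)
qed

text \<open>The value at x depends on V x alone, and a vector with coordinate 0 is also the value at
  x of the section 0 V, along which the derivative vanishes by linearity.\<close>

lemma lie_fun_coord_zero:
  assumes "V \<in> A1 G" "f \<in> C" "coord V x = 0"
  shows "L V f x = 0"
proof -
  have "(\<lambda>_. 0) \<in> C" by (rule C_const)
  then have "smult G (\<lambda>_. 0) V \<in> A1 G" "L (smult G (\<lambda>_. 0) V) f x = 0"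
    using assms by (simp_all add: smult_closed lie_fun_smult)
  moreover have "smult G (\<lambda>_. 0) V x = V x"
    using assms calculation(1) by (intro fibre_eqI A1_fibre) (simp_all add: coord_smult)
  ultimately show ?thesis
    by (simp add: lie_fun_def lie_derivative_def)
qed

lemma C_zero: "0 \<in> C"
  unfolding zero_fun_def by (rule C_const)

lemma C_minus: "f \<in> C \<Longrightarrow> - f \<in> C"
  using C_mult[OF C_const[of "-1"]] by (simp add: fun_eq_iff fun_Compl_def times_fun_def)

section \<open>Skew symmetry, Jacobi identity and Leibniz rules of the bracket\<close>

lemma bracket_sadd:
  assumes "s \<in> A1 G" "t \<in> A1 G" "u \<in> A1 G"
  shows "bracket G (sadd G s t) u = sadd G (bracket G s u) (bracket G t u)"
    and "bracket G u (sadd G s t) = sadd G (bracket G u s) (bracket G u t)"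
  using brackets assms by (simp_all add: lie_bracket_on_sections_def)

lemma coord_bracket_self: "s \<in> A1 G \<Longrightarrow> coord (bracket G s s) x = 0"
  using brackets coord_szero by (simp add: lie_bracket_on_sections_def)

text \<open>Polarization: the bracket of s + t with itself is 0.\<close>

lemma coord_bracket_skew:
  assumes "s \<in> A1 G" "t \<in> A1 G"
  shows "coord (bracket G s t) x = - coord (bracket G t s) x"
proof -
  have "coord (bracket G (sadd G s t) (sadd G s t)) x = 0"
    using assms by (simp add: coord_bracket_self sadd_closed)
  then show ?thesis
    using assms by (simp add: bracket_sadd sadd_closed bracket_closed coord_sadd coord_bracket_self
        eq_neg_iff_add_eq_0 add.commute)
qed

lemma bracket_skew:
  assumes "s \<in> A1 G" "t \<in> A1 G"
  shows "bracket G s t = smult G (\<lambda>_. -1) (bracket G t s)"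
  using assms coord_bracket_skew[OF assms]
  by (intro section_eqI) (simp_all add: bracket_closed smult_closed C_const coord_smult)

text \<open>Skew symmetry turns the cyclic Jacobi sum into the statement that bracketing with s is a
  derivation of the bracket. In this form it rewrites a nested bracket as a sum, which linear
  operators can split.\<close>

lemma coord_bracket_Jacobi:
  assumes "s \<in> A1 G" "t \<in> A1 G" "u \<in> A1 G"
  shows "coord (bracket G s (bracket G t u)) x
    = coord (bracket G (bracket G s t) u) x + coord (bracket G t (bracket G s u)) x"
proof -
  note cl = bracket_closed sadd_closed smult_closed C_const
  have "sadd G (bracket G s (bracket G t u))
          (sadd G (bracket G t (bracket G u s)) (bracket G u (bracket G s t))) = szero G"
    using brackets assms by (simp add: lie_bracket_on_sections_def)
  then have "coord (sadd G (bracket G s (bracket G t u))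
          (sadd G (bracket G t (bracket G u s)) (bracket G u (bracket G s t)))) x = 0"
    by (simp add: coord_szero)
  moreover have "bracket G t (bracket G u s) = smult G (\<lambda>_. -1) (bracket G t (bracket G s u))"
    using assms brackets bracket_skew[of u s] by (simp add: lie_bracket_on_sections_def)
  moreover have "coord (bracket G u (bracket G s t)) x = - coord (bracket G (bracket G s t) u) x"
    using assms by (intro coord_bracket_skew cl)
  ultimately show ?thesis
    using assms by (simp add: coord_sadd coord_smult cl algebra_simps)
qed

lemma bracket_Jacobi:
  assumes "s \<in> A1 G" "t \<in> A1 G" "u \<in> A1 G"
  shows "bracket G s (bracket G t u) = sadd G (bracket G (bracket G s t) u) (bracket G t (bracket G s u))"
  using assms by (intro section_eqI)
    (simp_all add: bracket_closed sadd_closed coord_sadd coord_bracket_Jacobi[of s t u])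

lemma bracket_Leibniz_left:
  assumes "s \<in> A1 G" "t \<in> A1 G" "f \<in> C"
  shows "bracket G (smult G f s) t = sadd G (smult G f (bracket G s t)) (smult G (- L t f) s)"
proof (rule section_eqI)
  note cl = bracket_closed sadd_closed smult_closed C_const lie_fun_closed C_minus
  fix x
  have "coord (bracket G (smult G f s) t) x = - coord (bracket G t (smult G f s)) x"
    using assms by (intro coord_bracket_skew cl)
  then show "coord (bracket G (smult G f s) t) x
      = coord (sadd G (smult G f (bracket G s t)) (smult G (- L t f) s)) x"
    using assms coord_bracket_skew[of s t x]
    by (simp add: bracket_Leibniz coord_sadd coord_smult cl)
qed (use assms in \<open>simp_all add: bracket_closed sadd_closed smult_closed C_const lie_fun_closed C_minus\<close>)

text \<open>Expanding the Jacobi identity for \<open>s\<close>, \<open>t\<close>, \<open>f u\<close> shows that the two sides agree after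
  multiplication with any section \<open>u\<close>.  At a point where every section vanishes, both sides are
  \<open>0\<close>, so no bump functions are needed.\<close>

lemma lie_fun_bracket:
  assumes "s \<in> A1 G" "t \<in> A1 G" "f \<in> C"
  shows "L (bracket G s t) f = L s (L t f) - L t (L s f)"
proof
  fix x
  note cl = bracket_closed sadd_closed smult_closed C_const lie_fun_closed
  show "L (bracket G s t) f x = (L s (L t f) - L t (L s f)) x"
  proof (cases "\<forall>u\<in>A1 G. coord u x = 0")
    case True
    then show ?thesis using assms by (simp add: lie_fun_coord_zero cl)
  next
    case False
    then obtain u where u: "u \<in> A1 G" "coord u x \<noteq> 0" by blast
    have "coord (bracket G s (bracket G t (smult G f u))) x =
        coord (bracket G (bracket G s t) (smult G f u)) x + coord (bracket G t (bracket G s (smult G f u))) x"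
      using assms u by (intro coord_bracket_Jacobi cl)
    then have "(L s (L t f) x - L t (L s f) x - L (bracket G s t) f x) *\<^sub>R coord u x = 0"
      using assms u by (simp add: bracket_Leibniz bracket_sadd coord_sadd coord_smult cl
          coord_bracket_Jacobi[of s t u] algebra_simps)
    then show ?thesis using u by simp
  qed
qed

end

section \<open>Cartan calculus of a Lie-Rinehart algebra\<close>

type_synonym ('s, 'r) lform = "'s list \<Rightarrow> 'r"

definition fscale :: "'r::comm_ring_1 \<Rightarrow> ('s, 'r) lform \<Rightarrow> ('s, 'r) lform" where
  "fscale f \<omega> = (\<lambda>Vs. f * \<omega> Vs)"

definition ins :: "'s \<Rightarrow> ('s, 'r) lform \<Rightarrow> ('s, 'r) lform" where
  "ins V \<omega> = (\<lambda>Vs. \<omega> (V # Vs))"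

lemma ins_apply: "ins V \<omega> Vs = \<omega> (V # Vs)"
  by (simp add: ins_def)

lemma fscale_apply [simp]: "fscale f \<omega> Vs = f * \<omega> Vs"
  by (simp add: fscale_def)

lemma ins_simps [simp]:
  fixes \<omega> \<eta> :: "('s, 'r::comm_ring_1) lform"
  shows "ins V (\<omega> + \<eta>) = ins V \<omega> + ins V \<eta>"
  "ins V (\<omega> - \<eta>) = ins V \<omega> - ins V \<eta>"
  "ins V (- \<omega>) = - ins V \<omega>"
  "ins V (fscale f \<omega>) = fscale f (ins V \<omega>)"
  "ins V (0 :: ('s, 'r) lform) = 0"
  by (simp_all add: fun_eq_iff ins_apply fscale_apply)

text \<open>\<open>C\<close> is a carrier inside \<open>'r\<close> because the intended ring
  consists of all functions and \<open>C\<close> of the smooth ones. Elements of \<open>X\<close>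
  are combined by \<open>add\<close> and \<open>smul\<close> without subtraction; equations between
  them take effect in the first slot of a form or of an operator, where linearity turns them into
  equations of values in the ring.\<close>

locale lie_rinehart =
  fixes C :: "'r::comm_ring_1 set" and X :: "'s set"
    and add :: "'s \<Rightarrow> 's \<Rightarrow> 's" and smul :: "'r \<Rightarrow> 's \<Rightarrow> 's"
    and br :: "'s \<Rightarrow> 's \<Rightarrow> 's" and L :: "'s \<Rightarrow> 'r \<Rightarrow> 'r"
  assumes C_one: "1 \<in> C" and C_add: "f \<in> C \<Longrightarrow> g \<in> C \<Longrightarrow> f + g \<in> C"
    and C_minus: "f \<in> C \<Longrightarrow> - f \<in> C" and C_mult: "f \<in> C \<Longrightarrow> g \<in> C \<Longrightarrow> f * g \<in> C"
    and add_closed: "V \<in> X \<Longrightarrow> W \<in> X \<Longrightarrow> add V W \<in> X"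
    and smul_closed: "f \<in> C \<Longrightarrow> V \<in> X \<Longrightarrow> smul f V \<in> X"
    and br_closed: "V \<in> X \<Longrightarrow> W \<in> X \<Longrightarrow> br V W \<in> X"
    and L_closed: "V \<in> X \<Longrightarrow> f \<in> C \<Longrightarrow> L V f \<in> C"
    and L_add: "V \<in> X \<Longrightarrow> f \<in> C \<Longrightarrow> g \<in> C \<Longrightarrow> L V (f + g) = L V f + L V g"
    and L_mult: "V \<in> X \<Longrightarrow> f \<in> C \<Longrightarrow> g \<in> C \<Longrightarrow> L V (f * g) = f * L V g + L V f * g"
    and L_add_left: "V \<in> X \<Longrightarrow> W \<in> X \<Longrightarrow> f \<in> C \<Longrightarrow> L (add V W) f = L V f + L W f"
    and L_smul: "V \<in> X \<Longrightarrow> g \<in> C \<Longrightarrow> f \<in> C \<Longrightarrow> L (smul g V) f = g * L V f"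
    and L_br: "V \<in> X \<Longrightarrow> W \<in> X \<Longrightarrow> f \<in> C \<Longrightarrow> L (br V W) f = L V (L W f) - L W (L V f)"
    and br_add: "U \<in> X \<Longrightarrow> V \<in> X \<Longrightarrow> W \<in> X \<Longrightarrow> br (add U V) W = add (br U W) (br V W)"
      "U \<in> X \<Longrightarrow> V \<in> X \<Longrightarrow> W \<in> X \<Longrightarrow> br U (add V W) = add (br U V) (br U W)"
    and br_skew: "V \<in> X \<Longrightarrow> W \<in> X \<Longrightarrow> br V W = smul (- 1) (br W V)"
    and br_Jacobi: "U \<in> X \<Longrightarrow> V \<in> X \<Longrightarrow> W \<in> X \<Longrightarrow>
      br U (br V W) = add (br (br U V) W) (br V (br U W))"
    and br_Leibniz: "V \<in> X \<Longrightarrow> W \<in> X \<Longrightarrow> f \<in> C \<Longrightarrow> br V (smul f W) = add (smul f (br V W)) (smul (L V f) W)"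
    and br_Leibniz_left: "V \<in> X \<Longrightarrow> W \<in> X \<Longrightarrow> f \<in> C \<Longrightarrow>
      br (smul f V) W = add (smul f (br V W)) (smul (- L W f) V)"
begin

lemma C_zero: "0 \<in> C"
  using C_add[OF C_one C_minus[OF C_one]] by simp

lemma C_diff: "f \<in> C \<Longrightarrow> g \<in> C \<Longrightarrow> f - g \<in> C"
  using C_add[OF _ C_minus] by fastforce

lemma L_zero: "V \<in> X \<Longrightarrow> L V 0 = 0"
  using L_add[of V 0 0] C_zero by simp

lemma L_minus: "V \<in> X \<Longrightarrow> f \<in> C \<Longrightarrow> L V (- f) = - L V f"
  using L_add[of V f "- f"] by (simp add: C_minus L_zero eq_neg_iff_add_eq_0 add.commute)

definition lie :: "'s \<Rightarrow> ('s, 'r) lform \<Rightarrow> ('s, 'r) lform" where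
  "lie V \<omega> = (\<lambda>Vs. if set Vs \<subseteq> X
     then L V (\<omega> Vs) - (\<Sum>i<length Vs. \<omega> (Vs[i := br V (Vs ! i)])) else 0)"

definition d :: "('s, 'r) lform \<Rightarrow> ('s, 'r) lform" where
  "d \<omega> = (\<lambda>Vs. if set Vs \<subseteq> X
     then (\<Sum>i<length Vs. (-1) ^ i * L (Vs ! i) (\<omega> (nths Vs (- {i}))))
        + (\<Sum>j<length Vs. \<Sum>i<j. (-1) ^ (i + j) * \<omega> (br (Vs ! i) (Vs ! j) # nths Vs (- {i, j})))
     else 0)"

text \<open>The recursions hold for arguments in \<open>X\<close>. The case \<open>outside\<close>
  collects the remaining lists, on which forms and the operators applied to them vanish.\<close>

lemma sect_list_induct [case_names outside Nil Cons]:
  assumes "\<And>Vs. \<not> set Vs \<subseteq> X \<Longrightarrow> P Vs" "P []"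
    and "\<And>V Vs. V \<in> X \<Longrightarrow> set Vs \<subseteq> X \<Longrightarrow> P Vs \<Longrightarrow> P (V # Vs)"
  shows "P Vs"
  using assms by (induction Vs) (metis list.set_intros(1) list.set_intros(2) subset_code(1))+

text \<open>Forms without a bound on the degree.  Linearity in the first slot suffices because of skew
  symmetry.\<close>

definition form :: "('s, 'r) lform \<Rightarrow> bool" where
  "form \<omega> \<longleftrightarrow>
     (\<forall>Vs. \<not> set Vs \<subseteq> X \<longrightarrow> \<omega> Vs = 0) \<and>
     (\<forall>Vs. \<omega> Vs \<in> C) \<and>
     (\<forall>V\<in>X. \<forall>W\<in>X. \<forall>Vs. \<omega> (add V W # Vs) = \<omega> (V # Vs) + \<omega> (W # Vs)) \<and>
     (\<forall>f\<in>C. \<forall>V\<in>X. \<forall>Vs. \<omega> (smul f V # Vs) = f * \<omega> (V # Vs)) \<and>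
     (\<forall>Us V W Vs. \<omega> (Us @ V # W # Vs) = - \<omega> (Us @ W # V # Vs))"

lemma
  assumes "form \<omega>"
  shows form_outside: "\<not> set Vs \<subseteq> X \<Longrightarrow> \<omega> Vs = 0"
    and form_C: "\<omega> Vs \<in> C"
    and form_add_left: "V \<in> X \<Longrightarrow> W \<in> X \<Longrightarrow> \<omega> (add V W # Vs) = \<omega> (V # Vs) + \<omega> (W # Vs)"
    and form_smul: "f \<in> C \<Longrightarrow> V \<in> X \<Longrightarrow> \<omega> (smul f V # Vs) = f * \<omega> (V # Vs)"
    and form_skew: "\<omega> (Us @ V # W # Vs) = - \<omega> (Us @ W # V # Vs)"
proof -
  note * = assms[unfolded form_def]
  show "\<omega> Vs = 0" if "\<not> set Vs \<subseteq> X"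
    using * that by blast
  show "\<omega> Vs \<in> C"
    using * by blast
  show "\<omega> (add V W # Vs) = \<omega> (V # Vs) + \<omega> (W # Vs)" if "V \<in> X" "W \<in> X"
    using * that by (elim conjE) blast
  show "\<omega> (smul f V # Vs) = f * \<omega> (V # Vs)" if "f \<in> C" "V \<in> X"
    using * that by (elim conjE) blast
  show "\<omega> (Us @ V # W # Vs) = - \<omega> (Us @ W # V # Vs)"
    using * by (elim conjE) (drule spec, drule spec, drule spec, erule spec)
qed

lemma form_skew0: "form \<omega> \<Longrightarrow> \<omega> (V # W # Vs) = - \<omega> (W # V # Vs)"
  using form_skew[of \<omega> "[]" V W Vs] by simp

lemma form_zero: "form 0"
  by (simp add: form_def C_zero)

lemma formI:
  assumes "\<And>Vs. \<not> set Vs \<subseteq> X \<Longrightarrow> \<omega> Vs = 0" "\<And>Vs. \<omega> Vs \<in> C"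
    and "\<And>V W Vs. V \<in> X \<Longrightarrow> W \<in> X \<Longrightarrow> \<omega> (add V W # Vs) = \<omega> (V # Vs) + \<omega> (W # Vs)"
    and "\<And>f V Vs. f \<in> C \<Longrightarrow> V \<in> X \<Longrightarrow> \<omega> (smul f V # Vs) = f * \<omega> (V # Vs)"
    and "\<And>Us V W Vs. \<omega> (Us @ V # W # Vs) = - \<omega> (Us @ W # V # Vs)"
  shows "form \<omega>"
  unfolding form_def by (intro conjI allI impI ballI assms)

lemma form_add:
  assumes "form \<omega>" "form \<eta>"
  shows "form (\<omega> + \<eta>)"
proof (rule formI)
  show "(\<omega> + \<eta>) (Us @ V # W # Vs) = - (\<omega> + \<eta>) (Us @ W # V # Vs)" for Us V W Vs
    using form_skew[OF assms(1), of Us V W Vs] form_skew[OF assms(2), of Us V W Vs] by simp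
qed (simp_all add: form_outside[OF assms(1)] form_outside[OF assms(2)] form_C C_add assms
    form_add_left[OF assms(1)] form_add_left[OF assms(2)] form_smul[OF assms(1)] form_smul[OF assms(2)]
    algebra_simps)

lemma form_fscale:
  assumes "form \<omega>" "f \<in> C"
  shows "form (fscale f \<omega>)"
proof (rule formI)
  show "fscale f \<omega> (Us @ V # W # Vs) = - fscale f \<omega> (Us @ W # V # Vs)" for Us V W Vs
    using form_skew[OF assms(1), of Us V W Vs] by simp
qed (simp_all add: form_outside[OF assms(1)] form_C C_mult assms form_add_left[OF assms(1)]
    form_smul[OF assms(1)] algebra_simps)

lemma form_uminus: "form \<omega> \<Longrightarrow> form (- \<omega>)"
proof -
  assume "form \<omega>"
  moreover have "- \<omega> = fscale (- 1) \<omega>"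
    by (simp add: fun_eq_iff)
  ultimately show ?thesis using form_fscale[OF _ C_minus[OF C_one]] by simp
qed

lemma form_diff: "form \<omega> \<Longrightarrow> form \<eta> \<Longrightarrow> form (\<omega> - \<eta>)"
  using form_add[OF _ form_uminus] by fastforce

text \<open>The first slot of \<open>ins V \<omega>\<close> is the second slot of
  \<open>\<omega>\<close>; skew symmetry brings it to the front, where linearity is known.\<close>

lemma form_ins:
  assumes "form \<omega>" "V \<in> X"
  shows "form (ins V \<omega>)"
proof (rule formI)
  show "ins V \<omega> (add A B # Vs) = ins V \<omega> (A # Vs) + ins V \<omega> (B # Vs)"
    if "A \<in> X" "B \<in> X" for A B Vs
    using that by (simp add: ins_apply form_skew0[OF assms(1), of V] form_add_left[OF assms(1)])
  show "ins V \<omega> (smul f A # Vs) = f * ins V \<omega> (A # Vs)" if "f \<in> C" "A \<in> X" for f A Vs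
    using that by (simp add: ins_apply form_skew0[OF assms(1), of V] form_smul[OF assms(1)])
  show "ins V \<omega> (Us @ A # B # Vs) = - ins V \<omega> (Us @ B # A # Vs)" for Us A B Vs
    using form_skew[OF assms(1), of "V # Us" A B Vs] by (simp add: ins_apply)
  show "ins V \<omega> Vs = 0" if "\<not> set Vs \<subseteq> X" for Vs
    using that form_outside[OF assms(1), of "V # Vs"] by (simp add: ins_apply)
  show "ins V \<omega> Vs \<in> C" for Vs
    using form_C[OF assms(1)] by (simp add: ins_apply)
qed

lemma form_ins_outside: "form \<omega> \<Longrightarrow> V \<notin> X \<Longrightarrow> ins V \<omega> = 0"
  by (rule ext) (simp add: ins_apply form_outside[of \<omega> "V # _"])

lemma ins_swap: "form \<omega> \<Longrightarrow> ins V (ins W \<omega>) = - ins W (ins V \<omega>)"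
  by (rule ext) (simp add: ins_apply form_skew0[of \<omega> W V])

lemma ins_add:
  "form \<omega> \<Longrightarrow> V \<in> X \<Longrightarrow> W \<in> X \<Longrightarrow> ins (add V W) \<omega> = ins V \<omega> + ins W \<omega>"
  by (rule ext) (simp add: ins_apply form_add_left[of \<omega>])

lemma ins_smul:
  "form \<omega> \<Longrightarrow> f \<in> C \<Longrightarrow> V \<in> X \<Longrightarrow> ins (smul f V) \<omega> = fscale f (ins V \<omega>)"
  by (rule ext) (simp add: ins_apply form_smul[of \<omega>])

lemma ins_br_swap:
  assumes "form \<omega>" "V \<in> X" "W \<in> X"
  shows "ins (br V W) \<omega> = - ins (br W V) \<omega>"
  using br_skew[OF assms(2,3)] ins_smul[OF assms(1) C_minus[OF C_one] br_closed[OF assms(3,2)]]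
  by (simp add: fun_eq_iff)

lemmas form_intros = form_add form_diff form_uminus form_fscale form_ins form_zero
  form_C br_closed add_closed smul_closed C_one L_closed C_zero C_add C_diff C_minus C_mult

section \<open>The Lie derivative of forms\<close>

lemma lie_outside: "\<not> set Vs \<subseteq> X \<Longrightarrow> lie V \<omega> Vs = 0"
  by (simp add: lie_def )

lemma lie_Nil: "lie V \<omega> [] = L V (\<omega> [])"
  by (simp add: lie_def fun_eq_iff)

text \<open>The summand at index 0 replaces W by its bracket with V, and the others make up the sum
  for \<open>ins W \<omega>\<close>.\<close>

lemma lie_Cons:
  assumes "form \<omega>" "W \<in> X"
  shows "lie V \<omega> (W # Vs) = lie V (ins W \<omega>) Vs - ins (br V W) \<omega> Vs"
proof (cases "set Vs \<subseteq> X")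
  case True
  then show ?thesis
    using assms by (simp add: ins_apply lie_def fun_eq_iff sum.lessThan_Suc_shift del: sum.lessThan_Suc)
next
  case False
  then show ?thesis
    using assms by (simp add: lie_outside ins_apply form_outside[OF assms(1)])
qed

lemma lie_add:
  assumes "form \<omega>" "form \<eta>" "V \<in> X"
  shows "lie V (\<omega> + \<eta>) = lie V \<omega> + lie V \<eta>"
proof
  fix Vs show "lie V (\<omega> + \<eta>) Vs = (lie V \<omega> + lie V \<eta>) Vs"
    using assms
    by (induction Vs arbitrary: \<omega> \<eta> rule: sect_list_induct)
      (simp_all add: lie_outside lie_Nil lie_Cons L_add form_intros)
qed

lemma lie_fscale:
  assumes "form \<omega>" "f \<in> C" "V \<in> X"
  shows "lie V (fscale f \<omega>) = fscale (L V f) \<omega> + fscale f (lie V \<omega>)"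
proof
  fix Vs show "lie V (fscale f \<omega>) Vs = (fscale (L V f) \<omega> + fscale f (lie V \<omega>)) Vs"
    using assms
  proof (induction Vs arbitrary: \<omega> rule: sect_list_induct)
    case (outside Vs)
    then show ?case by (simp add: lie_outside form_outside[of \<omega>])
  next
    case (Cons W Vs)
    have "lie V (fscale f (ins W \<omega>)) Vs = (fscale (L V f) (ins W \<omega>) + fscale f (lie V (ins W \<omega>))) Vs"
      by (rule Cons.IH) (use Cons in \<open>simp_all add: form_intros\<close>)
    then show ?case
      using Cons.prems Cons.hyps
      by (simp add: lie_Cons form_intros ins_apply[of _ _ Vs] fscale_apply[of _ _ Vs]
          fscale_apply[of _ _ "W # Vs"] algebra_simps del: fscale_apply)
  qed (simp add: lie_Nil L_mult form_intros algebra_simps)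
qed

lemma lie_uminus:
  assumes "form \<omega>" "V \<in> X"
  shows "lie V (- \<omega>) = - lie V \<omega>"
proof
  fix Vs show "lie V (- \<omega>) Vs = (- lie V \<omega>) Vs"
    using assms
    by (induction Vs arbitrary: \<omega> rule: sect_list_induct)
      (simp_all add: lie_outside lie_Nil lie_Cons L_minus form_intros)
qed

lemma lie_diff: "form \<omega> \<Longrightarrow> form \<eta> \<Longrightarrow> V \<in> X \<Longrightarrow> lie V (\<omega> - \<eta>) = lie V \<omega> - lie V \<eta>"
  using lie_add[of \<omega> "- \<eta>" V] by (simp add: lie_uminus form_intros)

lemma ins_lie:
  "form \<omega> \<Longrightarrow> V \<in> X \<Longrightarrow> W \<in> X \<Longrightarrow> ins W (lie V \<omega>) = lie V (ins W \<omega>) - ins (br V W) \<omega>"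
  by (rule ext) (simp add: ins_apply lie_Cons)

text \<open>The recursions can peel off only arguments in \<open>X\<close>. A list with an entry
  outside \<open>X\<close> keeps that entry under a swap, so both sides vanish together and only the
  cases accessible to a recursion remain.\<close>

lemma skew_induct_step:
  fixes F :: "('s, 'r) lform"
  assumes "\<And>Us' U. Us = U # Us' \<Longrightarrow> U \<in> X \<Longrightarrow> F (Us @ V # W # Vs) = - F (Us @ W # V # Vs)"
    and "V \<in> X \<Longrightarrow> W \<in> X \<Longrightarrow> Us = [] \<Longrightarrow> F (V # W # Vs) = - F (W # V # Vs)"
    and "\<And>Vs. \<not> set Vs \<subseteq> X \<Longrightarrow> F Vs = 0"
  shows "F (Us @ V # W # Vs) = - F (Us @ W # V # Vs)"
proof (cases "set (Us @ V # W # Vs) \<subseteq> X")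
  case True
  then show ?thesis using assms(1,2) by (cases Us) auto
next
  case False
  moreover from this have "\<not> set (Us @ W # V # Vs) \<subseteq> X" by auto
  ultimately show ?thesis using assms(3) by simp
qed

lemma form_lie:
  assumes "form \<omega>" "V \<in> X"
  shows "form (lie V \<omega>)"
proof (rule formI)
  show "lie V \<omega> Vs = 0" if "\<not> set Vs \<subseteq> X" for Vs
    using that by (rule lie_outside)
  show "lie V \<omega> Vs \<in> C" for Vs
    using assms by (induction Vs arbitrary: \<omega> rule: sect_list_induct)
      (simp_all add: lie_outside lie_Nil lie_Cons form_intros)
  show "lie V \<omega> (add A B # Vs) = lie V \<omega> (A # Vs) + lie V \<omega> (B # Vs)" if "A \<in> X" "B \<in> X" for A B Vs
    using assms that
    by (simp add: lie_Cons ins_add lie_add form_intros br_add)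
  \<comment> \<open>The term (L(V)f) i(A)\<omega> arises twice, from differentiating f and from the
    Leibniz rule of the bracket, with opposite signs.\<close>
  show "lie V \<omega> (smul f A # Vs) = f * lie V \<omega> (A # Vs)" if "f \<in> C" "A \<in> X" for f A Vs
    using assms that
    by (simp add: lie_Cons ins_smul lie_fscale form_intros br_Leibniz
        ins_add ins_apply[of A] algebra_simps)
  show "lie V \<omega> (Us @ A # B # Vs) = - lie V \<omega> (Us @ B # A # Vs)" for Us A B Vs
    using assms
  proof (induction Us arbitrary: \<omega>)
    case Nil
    note f = \<open>form \<omega>\<close> \<open>V \<in> X\<close>
    show ?case
    proof (rule skew_induct_step[where F = "lie V \<omega>", OF _ _ lie_outside])
      assume "A \<in> X" "B \<in> X"
      with f show "lie V \<omega> (A # B # Vs) = - lie V \<omega> (B # A # Vs)"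
        by (simp add: lie_Cons form_intros ins_swap[of \<omega> B A] lie_uminus
            ins_lie ins_apply form_skew0[of \<omega> "br V B" A] form_skew0[of \<omega> "br V A" B])
    qed simp
  next
    case (Cons U Us)
    note f = \<open>form \<omega>\<close> \<open>V \<in> X\<close>
    show ?case
    proof (rule skew_induct_step[where F = "lie V \<omega>", OF _ _ lie_outside])
      fix Us' U' assume "U # Us = U' # Us'" "U' \<in> X"
      then have "U \<in> X" by simp
      then show "lie V \<omega> ((U # Us) @ A # B # Vs) = - lie V \<omega> ((U # Us) @ B # A # Vs)"
        using f Cons.IH[OF form_ins, of \<omega> U] form_skew[OF form_ins, of \<omega> "br V U" Us A B Vs]
        by (simp add: lie_Cons form_intros)
    qed simp
  qed
qed

lemma lie_add_left:
  assumes "form \<omega>" "V \<in> X" "W \<in> X"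
  shows "lie (add V W) \<omega> = lie V \<omega> + lie W \<omega>"
proof
  fix Vs show "lie (add V W) \<omega> Vs = (lie V \<omega> + lie W \<omega>) Vs"
    using assms
    by (induction Vs arbitrary: \<omega> rule: sect_list_induct)
      (simp_all add: lie_outside lie_Nil lie_Cons L_add_left form_intros br_add
        ins_add)
qed

text \<open>Insert U into both sides. In the commutator the mixed terms cancel and the insertions of
  [V, [W, U]] and [W, [V, U]] remain with opposite signs; the Jacobi identity combines them into the
  insertion of [[V, W], U].\<close>

lemma lie_br:
  assumes "form \<omega>" "V \<in> X" "W \<in> X"
  shows "lie (br V W) \<omega> = lie V (lie W \<omega>) - lie W (lie V \<omega>)"
proof
  fix Vs show "lie (br V W) \<omega> Vs = (lie V (lie W \<omega>) - lie W (lie V \<omega>)) Vs"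
    using assms
  proof (induction Vs arbitrary: \<omega> rule: sect_list_induct)
    case (Cons U Vs)
    then show ?case
      by (simp add: lie_Cons form_intros form_lie ins_lie lie_diff
          br_Jacobi[of V W U] ins_add)
  qed (simp_all add: lie_outside lie_Nil L_br form_intros)
qed

section \<open>The exterior derivative\<close>

lemma d_outside: "\<not> set Vs \<subseteq> X \<Longrightarrow> d \<omega> Vs = 0"
  by (simp add: d_def )

lemma d_Nil: "d \<omega> [] = 0"
  by (simp add: d_def fun_eq_iff)

lemma nths_Cons_Compl:
  "nths (V # Vs) (- {0}) = Vs"
  "nths (V # Vs) (- {Suc k}) = V # nths Vs (- {k})"
  "nths (V # Vs) (- {0, Suc k}) = nths Vs (- {k})"
  "nths (V # Vs) (- {Suc l, Suc k}) = V # nths Vs (- {l, k})"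
proof -
  have *: "{j. Suc j \<in> - {0::nat}} = UNIV" "{j. Suc j \<in> - {Suc k}} = - {k}"
    "{j. Suc j \<in> - {0, Suc k}} = - {k}" "{j. Suc j \<in> - {Suc l, Suc k}} = - {l, k}" by auto
  show "nths (V # Vs) (- {0}) = Vs" "nths (V # Vs) (- {Suc k}) = V # nths Vs (- {k})"
    "nths (V # Vs) (- {0, Suc k}) = nths Vs (- {k})"
    "nths (V # Vs) (- {Suc l, Suc k}) = V # nths Vs (- {l, k})"
    unfolding nths_Cons * by (simp_all add: nths_all)
qed

text \<open>Moving an argument to the front takes i adjacent swaps. This links the slotwise formula
  for the Lie derivative with the formula for d, where brackets stand first, and it carries
  linearity from the first slot to every slot.\<close>

lemma form_move_front:
  assumes "form \<omega>" "i < length Vs" "set Vs \<subseteq> X"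
  shows "\<omega> (Vs[i := W]) = (-1) ^ i * \<omega> (W # nths Vs (- {i}))"
  using assms
proof (induction Vs arbitrary: i \<omega>)
  case (Cons V Vs)
  show ?case
  proof (cases i)
    case 0
    then show ?thesis by (simp add: nths_Cons_Compl)
  next
    case (Suc k)
    have "\<omega> (V # Vs[k := W]) = (-1) ^ k * \<omega> (V # W # nths Vs (- {k}))"
      using Cons.IH[OF form_ins, of \<omega> V k] Cons.prems Suc by (simp add: ins_apply)
    then show ?thesis
      using Suc form_skew0[OF Cons.prems(1), of V W] by (simp add: nths_Cons_Compl)
  qed
qed simp

lemma d_Cons:
  assumes "form \<omega>" "V \<in> X"
  shows "d \<omega> (V # Vs) = lie V \<omega> Vs - d (ins V \<omega>) Vs"
proof (cases "set Vs \<subseteq> X")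
  case True
  show ?thesis
  proof -
    let ?n = "length Vs"
    \<comment> \<open>Apart from L(V)(\<omega>(Vs)), the terms of d\<omega> at V # Vs are of three
      kinds: \<open>a\<close> differentiates along another argument, \<open>b\<close> brackets V
      with another argument, \<open>c\<close> brackets two others. The Lie derivative accounts for
      \<open>b\<close>, and d(i(V)\<omega>) for \<open>a\<close> and \<open>c\<close>.\<close>
    define a where "a = (\<Sum>k<?n. (-1) ^ k * L (Vs ! k) (\<omega> (V # nths Vs (- {k}))))"
    define b where "b = (\<Sum>k<?n. (-1) ^ k * \<omega> (br V (Vs ! k) # nths Vs (- {k})))"
    define c where "c = (\<Sum>k<?n. \<Sum>l<k. (-1) ^ (l + k) * \<omega> (V # br (Vs ! l) (Vs ! k) # nths Vs (- {l, k})))"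
    have "d \<omega> (V # Vs) = L V (\<omega> Vs) - a - b - c"
    proof -
      have "(\<Sum>k<?n. (-1) ^ Suc k * L (Vs ! k) (\<omega> (V # nths Vs (- {k})))) = - a"
        by (simp add: a_def sum_negf)
      \<comment> \<open>In the double sum both indices rise by one, which leaves the sign alone; the
        minus of \<open>c\<close> comes from moving V in front of the bracket.\<close>
      moreover have "(\<Sum>k<?n. (-1) ^ Suc k * \<omega> (br V (Vs ! k) # nths Vs (- {k}))
          + (\<Sum>l<k. (-1) ^ (Suc l + Suc k) * \<omega> (br (Vs ! l) (Vs ! k) # V # nths Vs (- {l, k})))) = - b - c"
        using form_skew0[OF assms(1), of V]
        by (simp add: b_def c_def sum.distrib sum_negf sum_subtractf)
      moreover have "d \<omega> (V # Vs) = L V (\<omega> Vs)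
          + (\<Sum>k<?n. (-1) ^ Suc k * L (Vs ! k) (\<omega> (V # nths Vs (- {k}))))
          + (\<Sum>k<?n. (-1) ^ Suc k * \<omega> (br V (Vs ! k) # nths Vs (- {k}))
          + (\<Sum>l<k. (-1) ^ (Suc l + Suc k) * \<omega> (br (Vs ! l) (Vs ! k) # V # nths Vs (- {l, k}))))"
        using True assms(2)
        by (simp only: d_def length_Cons sum.lessThan_Suc_shift nths_Cons_Compl nth_Cons_0 nth_Cons_Suc)
          (simp add: nths_Cons_Compl)
      ultimately show ?thesis by simp
    qed
    moreover have "lie V \<omega> Vs = L V (\<omega> Vs) - b"
      using True by (simp add: lie_def b_def form_move_front[OF assms(1)])
    moreover have "d (ins V \<omega>) Vs = a + c"
      using True by (simp add: d_def a_def c_def ins_apply)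
    ultimately show ?thesis
      by simp
  qed
next
  case False
  then show ?thesis using assms by (simp add: d_outside lie_outside)
qed

lemma ins_d: "form \<omega> \<Longrightarrow> V \<in> X \<Longrightarrow> ins V (d \<omega>) = lie V \<omega> - d (ins V \<omega>)"
  by (rule ext) (simp add: ins_apply d_Cons)

lemma d_add:
  assumes "form \<omega>" "form \<eta>"
  shows "d (\<omega> + \<eta>) = d \<omega> + d \<eta>"
proof
  fix Vs show "d (\<omega> + \<eta>) Vs = (d \<omega> + d \<eta>) Vs"
    using assms
    by (induction Vs arbitrary: \<omega> \<eta> rule: sect_list_induct)
      (simp_all add: d_outside d_Nil d_Cons lie_add form_intros)
qed

lemma d_zero: "d 0 = 0"
  using d_add[OF form_zero form_zero] by simp

lemma d_uminus: "form \<omega> \<Longrightarrow> d (- \<omega>) = - d \<omega>"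
  using d_add[of \<omega> "- \<omega>"] by (simp add: d_zero form_intros eq_neg_iff_add_eq_0 add.commute)

lemma d_diff: "form \<omega> \<Longrightarrow> form \<eta> \<Longrightarrow> d (\<omega> - \<eta>) = d \<omega> - d \<eta>"
  using d_add[of \<omega> "- \<eta>"] by (simp add: d_uminus form_intros)

text \<open>\<open>df_wedge Vs f \<eta>\<close> is the value of \<open>d f \<and> \<eta>\<close> at \<open>Vs\<close>.\<close>

primrec df_wedge :: "'s list \<Rightarrow> ('r) \<Rightarrow> ('s, 'r) lform \<Rightarrow> 'r" where
  "df_wedge [] f \<eta> = 0"
| "df_wedge (V # Vs) f \<eta> = L V f * \<eta> Vs - df_wedge Vs f (ins V \<eta>)"

lemma df_wedge_uminus: "df_wedge Vs f (- \<eta>) = - df_wedge Vs f \<eta>"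
  by (induction Vs arbitrary: \<eta>) simp_all

text \<open>The left Leibniz rule for the bracket of fV with W leaves the term -(L(W)f) V. Collected
  over all arguments W, these terms give df \<and> i(V)\<omega>.\<close>

lemma lie_smul:
  assumes "set Vs \<subseteq> X" "form \<omega>" "f \<in> C" "V \<in> X"
  shows "lie (smul f V) \<omega> Vs = f * lie V \<omega> Vs + df_wedge Vs f (ins V \<omega>)"
  using assms
proof (induction Vs arbitrary: \<omega>)
  case Nil
  then show ?case by (simp add: lie_Nil L_smul form_intros)
next
  case (Cons W Vs)
  then show ?case
    by (simp add: lie_Cons form_intros br_Leibniz_left ins_add ins_smul
        ins_apply[of V \<omega> Vs] ins_swap[of \<omega> V W] df_wedge_uminus algebra_simps)
qed

lemma d_fscale:
  assumes "set Vs \<subseteq> X" "form \<omega>" "f \<in> C"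
  shows "d (fscale f \<omega>) Vs = f * d \<omega> Vs + df_wedge Vs f \<omega>"
  using assms
  by (induction Vs arbitrary: \<omega>)
    (simp_all add: d_Nil d_Cons lie_fscale form_intros algebra_simps)

lemma form_d:
  assumes "form \<omega>"
  shows "form (d \<omega>)"
proof (rule formI)
  show "d \<omega> Vs = 0" if "\<not> set Vs \<subseteq> X" for Vs
    using that by (rule d_outside)
  show "d \<omega> Vs \<in> C" for Vs
    using assms by (induction Vs arbitrary: \<omega> rule: sect_list_induct)
      (simp_all add: d_outside d_Nil d_Cons form_intros form_lie)
  show "d \<omega> (add A B # Vs) = d \<omega> (A # Vs) + d \<omega> (B # Vs)" if "A \<in> X" "B \<in> X" for A B Vs
    using assms that
    by (simp add: d_Cons ins_add lie_add_left form_intros d_add)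
  \<comment> \<open>By Cartan's formula the left side is L(fA)\<omega> - d(f i(A)\<omega>). Both
    parts contribute df \<and> i(A)\<omega>, and the two contributions cancel.\<close>
  show "d \<omega> (smul f A # Vs) = f * d \<omega> (A # Vs)" if "f \<in> C" "A \<in> X" for f A Vs
  proof (cases "set Vs \<subseteq> X")
    case True
    then show ?thesis
      using assms that
      by (simp add: d_Cons ins_smul lie_smul d_fscale form_intros algebra_simps)
  qed (simp add: d_outside)
  show "d \<omega> (Us @ A # B # Vs) = - d \<omega> (Us @ B # A # Vs)" for Us A B Vs
    using assms
  proof (induction Us arbitrary: \<omega>)
    case Nil
    show ?case
    proof (rule skew_induct_step[where F = "d \<omega>", OF _ _ d_outside])
      assume "A \<in> X" "B \<in> X"
      \<comment> \<open>Unfolding two arguments gives L(A)i(B)\<omega> - i([A, B])\<omega> -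
        L(B)i(A)\<omega> + d(i(B)i(A)\<omega>), which changes sign when A and B are
        exchanged.\<close>
      with Nil show "d \<omega> (A # B # Vs) = - d \<omega> (B # A # Vs)"
        by (simp add: d_Cons lie_Cons form_intros ins_swap[of \<omega> B A] d_uminus
            ins_br_swap[of \<omega> B A])
    qed simp
  next
    case (Cons U Us)
    show ?case
    proof (rule skew_induct_step[where F = "d \<omega>", OF _ _ d_outside])
      fix Us' U' assume "U # Us = U' # Us'" "U' \<in> X"
      then have "U \<in> X" by simp
      then show "d \<omega> ((U # Us) @ A # B # Vs) = - d \<omega> ((U # Us) @ B # A # Vs)"
        using Cons.prems Cons.IH[of "ins U \<omega>"] form_skew[OF form_lie, of \<omega> U Us A B Vs]
        by (simp add: d_Cons form_intros)
    qed simp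
  qed
qed

text \<open>After insertion of W, the induction hypothesis for i(W)\<omega> removes all terms with d
  except d(i([V, W])\<omega>), which stands on both sides. What remains is L(V)L(W) - L([V, W]) =
  L(W)L(V), that is, \<open>lie_br\<close>.\<close>

lemma lie_d:
  assumes "form \<omega>" "V \<in> X"
  shows "lie V (d \<omega>) = d (lie V \<omega>)"
proof
  fix Vs show "lie V (d \<omega>) Vs = d (lie V \<omega>) Vs"
    using assms
  proof (induction Vs arbitrary: \<omega> rule: sect_list_induct)
    case (Cons W Vs)
    then show ?case
      by (simp add: lie_Cons d_Cons ins_d lie_diff d_diff form_d form_lie form_intros
          ins_lie lie_br)
  qed (simp_all add: lie_outside d_outside lie_Nil d_Nil L_zero)
qed

text \<open>Cartan's formula applied twice gives i(V)dd = L(V)d - dL(V) + dd i(V). The first two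
  terms cancel, and the last is the induction hypothesis for i(V)\<omega>.\<close>

lemma d_d:
  assumes "form \<omega>"
  shows "d (d \<omega>) = 0"
proof
  fix Vs show "d (d \<omega>) Vs = 0 Vs"
    using assms
    by (induction Vs arbitrary: \<omega> rule: sect_list_induct)
      (simp_all add: d_outside d_Nil d_Cons ins_d d_diff form_d form_lie form_intros lie_d)
qed

end

section \<open>Shuffles\<close>

text \<open>Every permutation of \<open>{..<Suc n}\<close> arises from one of \<open>{..<n}\<close> by inserting the value \<open>0\<close>
  at some position \<open>m\<close>; a shuffle has its value \<open>0\<close> at the beginning of one of its two blocks.\<close>

definition insert_zero :: "nat \<Rightarrow> (nat \<Rightarrow> nat) \<Rightarrow> nat \<Rightarrow> nat" where
  "insert_zero m \<sigma> k = (if k = m then 0 else Suc (\<sigma> (if k < m then k else k - 1)))"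

text \<open>Shifting the inserted value one position to the right costs one adjacent transposition;
  this is the origin of the sign (-1)^m.\<close>

lemma insert_zero_Suc: "insert_zero (Suc m) \<sigma> = insert_zero m \<sigma> \<circ> Transposition.transpose m (Suc m)"
  by (rule ext) (auto simp: insert_zero_def Transposition.transpose_def)

lemma insert_zero_0_permutes:
  assumes "\<sigma> permutes {..<n}"
  shows "insert_zero 0 \<sigma> permutes {..<Suc n} \<and> sign (insert_zero 0 \<sigma>) = sign \<sigma>"
  using assms finite_lessThan
proof (induction rule: permutes_induct)
  case id
  have "insert_zero 0 id = id" by (rule ext) (simp add: insert_zero_def)
  then show ?case by (metis permutes_id sign_id)
next
  case (swap a b p)
  have e: "insert_zero 0 (Transposition.transpose a b \<circ> p) = Transposition.transpose (Suc a) (Suc b) \<circ> insert_zero 0 p"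
    by (rule ext) (auto simp: insert_zero_def Transposition.transpose_def)
  have p: "permutation (insert_zero 0 p)" "permutation p"
    using swap permutation_permutes finite_lessThan by blast+
  have "Transposition.transpose (Suc a) (Suc b) permutes {..<Suc n}"
    using swap by (intro permutes_swap_id) auto
  then show ?case
    unfolding e using swap
    by (intro conjI permutes_compose; (subst sign_compose)?)
      (simp_all add: sign_compose[OF permutation_swap_id p(2)] permutation_swap_id sign_swap_id p)
qed

lemma insert_zero_permutes:
  assumes "\<sigma> permutes {..<n}" "m \<le> n"
  shows "insert_zero m \<sigma> permutes {..<Suc n}" "sign (insert_zero m \<sigma>) = (- 1) ^ m * sign \<sigma>"
proof -
  have "insert_zero m \<sigma> permutes {..<Suc n} \<and> sign (insert_zero m \<sigma>) = (- 1) ^ m * sign \<sigma>"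
    using assms(2)
  proof (induction m)
    case 0
    then show ?case using insert_zero_0_permutes[OF assms(1)] by simp
  next
    case (Suc m)
    then have IH: "insert_zero m \<sigma> permutes {..<Suc n}" "sign (insert_zero m \<sigma>) = (- 1) ^ m * sign \<sigma>"
      by simp_all
    have "Transposition.transpose m (Suc m) permutes {..<Suc n}"
      using Suc.prems by (intro permutes_swap_id) auto
    moreover have "permutation (insert_zero m \<sigma>)"
      using IH(1) permutation_permutes finite_lessThan by blast
    ultimately show ?case
      unfolding insert_zero_Suc using IH
      by (intro conjI permutes_compose; (subst sign_compose)?)
        (simp_all add: permutation_swap_id sign_swap_id)
  qed
  then show "insert_zero m \<sigma> permutes {..<Suc n}" "sign (insert_zero m \<sigma>) = (- 1) ^ m * sign \<sigma>"
    by simp_all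
qed

lemma permutes_insert_zero_ex:
  assumes "\<sigma> permutes {..<Suc n}" "\<sigma> m = 0" "m \<le> n"
  shows "\<exists>\<tau>. \<tau> permutes {..<n} \<and> \<sigma> = insert_zero m \<tau>"
  using assms
proof (induction m arbitrary: \<sigma>)
  case 0
  \<comment> \<open>Drop position 0 and lower the remaining values by one. They are positive because
    0 is already taken, so the subtraction is not truncated.\<close>
  define \<tau> where "\<tau> k = \<sigma> (Suc k) - 1" for k
  have nz: "\<sigma> (Suc k) \<noteq> 0" for k
    using permutes_inj[OF 0(1)] 0(2) by (metis injD nat.distinct(1))
  have inj: "inj \<tau>"
    using permutes_inj[OF 0(1)] nz unfolding \<tau>_def
    by (intro injI) (metis One_nat_def Suc_pred injD nat.inject not_gr_zero)
  have "\<tau> k < n" if "k < n" for k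
    using permutes_in_image[OF 0(1), of "Suc k"] nz[of k] that by (auto simp: \<tau>_def)
  then have "bij_betw \<tau> {..<n} {..<n}"
    using inj by (intro bij_betw_imageI endo_inj_surj) (auto intro: inj_on_subset)
  moreover have "\<tau> k = k" if "k \<notin> {..<n}" for k
    using permutes_not_in[OF 0(1), of "Suc k"] that by (simp add: \<tau>_def)
  ultimately have "\<tau> permutes {..<n}"
    by (rule bij_imp_permutes)
  moreover have "\<sigma> = insert_zero 0 \<tau>"
  proof
    show "\<sigma> k = insert_zero 0 \<tau> k" for k
      using 0(2) nz[of "k - 1"] by (cases k) (simp_all add: insert_zero_def \<tau>_def)
  qed
  ultimately show ?case by blast
next
  case (Suc m)
  let ?\<sigma> = "\<sigma> \<circ> Transposition.transpose m (Suc m)"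
  have "Transposition.transpose m (Suc m) permutes {..<Suc n}"
    using Suc.prems by (intro permutes_swap_id) auto
  then have "?\<sigma> permutes {..<Suc n}"
    using Suc.prems(1) by (intro permutes_compose)
  moreover have "?\<sigma> m = 0" "m \<le> n"
    using Suc.prems by simp_all
  ultimately obtain \<tau> where \<tau>: "\<tau> permutes {..<n}" "?\<sigma> = insert_zero m \<tau>"
    using Suc.IH by blast
  have "\<sigma> = ?\<sigma> \<circ> Transposition.transpose m (Suc m)"
    by (simp add: comp_assoc)
  then have "\<sigma> = insert_zero (Suc m) \<tau>"
    unfolding insert_zero_Suc \<tau>(2)[symmetric] .
  then show ?case using \<tau>(1) by blast
qed

lemma inj_insert_zero: "inj (insert_zero m)"
proof (rule injI, rule ext)
  fix \<sigma> \<tau> k assume "insert_zero m \<sigma> = insert_zero m \<tau>"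
  then have "insert_zero m \<sigma> (if k < m then k else Suc k) = insert_zero m \<tau> (if k < m then k else Suc k)"
    by simp
  then show "\<sigma> k = \<tau> k"
    by (auto simp: insert_zero_def split: if_splits)
qed

lemma insert_zero_0_shuffle:
  "insert_zero 0 \<tau> permutes {..<Suc p + q} \<Longrightarrow> \<tau> permutes {..<p + q} \<Longrightarrow>
    insert_zero 0 \<tau> \<in> shuffle_perms (Suc p) q \<longleftrightarrow> \<tau> \<in> shuffle_perms p q"
proof -
  have "strict_mono_on {..<Suc p} (insert_zero 0 \<tau>) \<longleftrightarrow> strict_mono_on {..<p} \<tau>"
  proof
    assume h: "strict_mono_on {..<Suc p} (insert_zero 0 \<tau>)"
    show "strict_mono_on {..<p} \<tau>"
    proof (rule strict_mono_onI)
      fix r s assume "r \<in> {..<p}" "s \<in> {..<p}" "r < s"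
      then show "\<tau> r < \<tau> s"
        using strict_mono_onD[OF h, of "Suc r" "Suc s"] by (simp add: insert_zero_def)
    qed
  next
    assume h: "strict_mono_on {..<p} \<tau>"
    show "strict_mono_on {..<Suc p} (insert_zero 0 \<tau>)"
    proof (rule strict_mono_onI)
      fix r s assume "r \<in> {..<Suc p}" "s \<in> {..<Suc p}" "r < s"
      then show "insert_zero 0 \<tau> r < insert_zero 0 \<tau> s"
        using strict_mono_onD[OF h, of "r - 1" "s - 1"] by (auto simp: insert_zero_def)
    qed
  qed
  moreover have "strict_mono_on {Suc p..<Suc p + q} (insert_zero 0 \<tau>) \<longleftrightarrow> strict_mono_on {p..<p + q} \<tau>"
  proof
    assume h: "strict_mono_on {Suc p..<Suc p + q} (insert_zero 0 \<tau>)"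
    show "strict_mono_on {p..<p + q} \<tau>"
    proof (rule strict_mono_onI)
      fix r s assume "r \<in> {p..<p + q}" "s \<in> {p..<p + q}" "r < s"
      then show "\<tau> r < \<tau> s"
        using strict_mono_onD[OF h, of "Suc r" "Suc s"] by (simp add: insert_zero_def)
    qed
  next
    assume h: "strict_mono_on {p..<p + q} \<tau>"
    show "strict_mono_on {Suc p..<Suc p + q} (insert_zero 0 \<tau>)"
    proof (rule strict_mono_onI)
      fix r s assume "r \<in> {Suc p..<Suc p + q}" "s \<in> {Suc p..<Suc p + q}" "r < s"
      then show "insert_zero 0 \<tau> r < insert_zero 0 \<tau> s"
        using strict_mono_onD[OF h, of "r - 1" "s - 1"] by (auto simp: insert_zero_def)
    qed
  qed
  moreover assume "insert_zero 0 \<tau> permutes {..<Suc p + q}" "\<tau> permutes {..<p + q}"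
  ultimately show ?thesis by (simp add: shuffle_perms_def)
qed

lemma insert_zero_shuffle:
  "insert_zero p \<tau> permutes {..<p + Suc q} \<Longrightarrow> \<tau> permutes {..<p + q} \<Longrightarrow>
    insert_zero p \<tau> \<in> shuffle_perms p (Suc q) \<longleftrightarrow> \<tau> \<in> shuffle_perms p q"
proof -
  have "strict_mono_on {..<p} (insert_zero p \<tau>) \<longleftrightarrow> strict_mono_on {..<p} \<tau>"
    by (auto simp: monotone_on_def insert_zero_def)
  moreover have "strict_mono_on {p..<p + Suc q} (insert_zero p \<tau>) \<longleftrightarrow> strict_mono_on {p..<p + q} \<tau>"
  proof
    assume h: "strict_mono_on {p..<p + Suc q} (insert_zero p \<tau>)"
    show "strict_mono_on {p..<p + q} \<tau>"
    proof (rule strict_mono_onI)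
      fix r s assume "r \<in> {p..<p + q}" "s \<in> {p..<p + q}" "r < s"
      then show "\<tau> r < \<tau> s"
        using strict_mono_onD[OF h, of "Suc r" "Suc s"] by (simp add: insert_zero_def)
    qed
  next
    assume h: "strict_mono_on {p..<p + q} \<tau>"
    show "strict_mono_on {p..<p + Suc q} (insert_zero p \<tau>)"
    proof (rule strict_mono_onI)
      fix r s assume "r \<in> {p..<p + Suc q}" "s \<in> {p..<p + Suc q}" "r < s"
      then show "insert_zero p \<tau> r < insert_zero p \<tau> s"
        using strict_mono_onD[OF h, of "r - 1" "s - 1"] by (auto simp: insert_zero_def)
    qed
  qed
  moreover assume "insert_zero p \<tau> permutes {..<p + Suc q}" "\<tau> permutes {..<p + q}"
  ultimately show ?thesis by (simp add: shuffle_perms_def)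
qed

text \<open>The value 0 is the least, and both blocks are increasing, so it must stand at the
  beginning of its block.\<close>

lemma shuffle_zero:
  assumes "\<sigma> \<in> shuffle_perms p q" "p + q > 0"
  shows "p > 0 \<and> \<sigma> 0 = 0 \<or> q > 0 \<and> \<sigma> p = 0"
proof -
  have \<sigma>: "\<sigma> permutes {..<p + q}" "strict_mono_on {..<p} \<sigma>" "strict_mono_on {p..<p + q} \<sigma>"
    using assms by (auto simp: shuffle_perms_def)
  obtain k where k: "\<sigma> k = 0" "k < p + q"
    using permutes_image[OF \<sigma>(1)] assms(2) by (metis imageE lessThan_iff)
  show ?thesis
  proof (cases "k < p")
    case True
    then show ?thesis using strict_mono_onD[OF \<sigma>(2), of 0 k] k by fastforce
  next
    case False
    then show ?thesis using strict_mono_onD[OF \<sigma>(3), of p k] k by fastforce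
  qed
qed

lemma finite_shuffle_perms: "finite (shuffle_perms p q)"
  by (rule finite_subset[OF _ finite_permutations[of "{..<p + q}"]]) (auto simp: shuffle_perms_def)

lemma shuffle_perms_zero_first:
  "{\<sigma> \<in> shuffle_perms (Suc p) q. \<sigma> 0 = 0} = insert_zero 0 ` shuffle_perms p q"
proof (intro equalityI subsetI)
  fix \<sigma> assume "\<sigma> \<in> {\<sigma> \<in> shuffle_perms (Suc p) q. \<sigma> 0 = 0}"
  then have \<sigma>: "\<sigma> \<in> shuffle_perms (Suc p) q" "\<sigma> 0 = 0" by simp_all
  then have "\<sigma> permutes {..<Suc (p + q)}" by (simp add: shuffle_perms_def)
  from permutes_insert_zero_ex[OF this \<sigma>(2)] obtain \<tau> where "\<tau> permutes {..<p + q}" "\<sigma> = insert_zero 0 \<tau>"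
    by auto
  then show "\<sigma> \<in> insert_zero 0 ` shuffle_perms p q"
    using \<sigma> insert_zero_0_shuffle[of \<tau> p q] by (auto simp: shuffle_perms_def)
next
  fix \<sigma> assume "\<sigma> \<in> insert_zero 0 ` shuffle_perms p q"
  then obtain \<tau> where \<tau>: "\<tau> \<in> shuffle_perms p q" "\<sigma> = insert_zero 0 \<tau>" by blast
  then have "\<tau> permutes {..<p + q}" by (simp add: shuffle_perms_def)
  then show "\<sigma> \<in> {\<sigma> \<in> shuffle_perms (Suc p) q. \<sigma> 0 = 0}"
    using \<tau> insert_zero_0_shuffle[of \<tau> p q] insert_zero_permutes(1)[of \<tau> "p + q" 0]
    by (simp add: insert_zero_def)
qed

lemma shuffle_perms_zero_second:
  "{\<sigma> \<in> shuffle_perms p (Suc q). \<sigma> p = 0} = insert_zero p ` shuffle_perms p q"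
proof (intro equalityI subsetI)
  fix \<sigma> assume "\<sigma> \<in> {\<sigma> \<in> shuffle_perms p (Suc q). \<sigma> p = 0}"
  then have \<sigma>: "\<sigma> \<in> shuffle_perms p (Suc q)" "\<sigma> p = 0" by simp_all
  then have "\<sigma> permutes {..<Suc (p + q)}" by (simp add: shuffle_perms_def)
  from permutes_insert_zero_ex[OF this \<sigma>(2)] obtain \<tau> where "\<tau> permutes {..<p + q}" "\<sigma> = insert_zero p \<tau>"
    by auto
  then show "\<sigma> \<in> insert_zero p ` shuffle_perms p q"
    using \<sigma> insert_zero_shuffle[of p \<tau> q] by (auto simp: shuffle_perms_def)
next
  fix \<sigma> assume "\<sigma> \<in> insert_zero p ` shuffle_perms p q"
  then obtain \<tau> where \<tau>: "\<tau> \<in> shuffle_perms p q" "\<sigma> = insert_zero p \<tau>" by blast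
  then have "\<tau> permutes {..<p + q}" by (simp add: shuffle_perms_def)
  then show "\<sigma> \<in> {\<sigma> \<in> shuffle_perms p (Suc q). \<sigma> p = 0}"
    using \<tau> insert_zero_shuffle[of p \<tau> q] insert_zero_permutes(1)[of \<tau> "p + q" p]
    by (simp add: insert_zero_def)
qed

text \<open>The split is by the block that contains the value 0, that is, by the factor of the wedge
  product that receives the first argument.\<close>

lemma sum_shuffles_Suc:
  fixes F :: "nat \<Rightarrow> (nat \<Rightarrow> nat) \<Rightarrow> 'a::comm_monoid_add"
  shows "(\<Sum>p\<le>Suc n. \<Sum>\<sigma>\<in>shuffle_perms p (Suc n - p). F p \<sigma>) =
    (\<Sum>p\<le>n. \<Sum>\<tau>\<in>shuffle_perms p (n - p). F (Suc p) (insert_zero 0 \<tau>)) +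
    (\<Sum>p\<le>n. \<Sum>\<tau>\<in>shuffle_perms p (n - p). F p (insert_zero p \<tau>))"
proof -
  \<comment> \<open>For p = 0, position 0 begins the second block; the condition p > 0 leaves that
    case to \<open>B\<close> and makes the two sets disjoint.\<close>
  define A where "A p = {\<sigma> \<in> shuffle_perms p (Suc n - p). p > 0 \<and> \<sigma> 0 = 0}" for p
  define B where "B p = {\<sigma> \<in> shuffle_perms p (Suc n - p). p \<le> n \<and> \<sigma> p = 0}" for p
  have split: "sum (F p) (shuffle_perms p (Suc n - p)) = sum (F p) (A p) + sum (F p) (B p)"
    if "p \<le> Suc n" for p
  proof -
    have "\<sigma> \<in> A p \<union> B p" if \<sigma>: "\<sigma> \<in> shuffle_perms p (Suc n - p)" for \<sigma>
      using shuffle_zero[OF \<sigma>] \<sigma> \<open>p \<le> Suc n\<close> unfolding A_def B_def by auto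
    moreover have "A p \<subseteq> shuffle_perms p (Suc n - p)" "B p \<subseteq> shuffle_perms p (Suc n - p)"
      by (auto simp: A_def B_def)
    ultimately have "shuffle_perms p (Suc n - p) = A p \<union> B p"
      by blast
    moreover have "A p \<inter> B p = {}"
    proof -
      have False if "\<sigma> \<in> A p" "\<sigma> \<in> B p" for \<sigma>
      proof -
        have "inj \<sigma>" using that permutes_inj by (auto simp: A_def shuffle_perms_def)
        then show False using that by (auto simp: A_def B_def dest: injD[of \<sigma> 0 p])
      qed
      then show ?thesis by blast
    qed
    moreover have "finite (A p)" "finite (B p)"
      unfolding A_def B_def by (simp_all add: finite_shuffle_perms)
    ultimately show ?thesis by (simp add: sum.union_disjoint)
  qed
  have A: "A (Suc p) = insert_zero 0 ` shuffle_perms p (n - p)" for p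
    unfolding A_def shuffle_perms_zero_first[symmetric] by simp
  have B: "B p = insert_zero p ` shuffle_perms p (n - p)" if "p \<le> n" for p
    unfolding B_def shuffle_perms_zero_second[symmetric] using that by (simp add: Suc_diff_le)
  have "(\<Sum>p\<le>Suc n. \<Sum>\<sigma>\<in>shuffle_perms p (Suc n - p). F p \<sigma>) =
      (\<Sum>p\<le>Suc n. sum (F p) (A p)) + (\<Sum>p\<le>Suc n. sum (F p) (B p))"
    by (subst sum.distrib[symmetric]) (rule sum.cong, auto simp: split)
  also have "(\<Sum>p\<le>Suc n. sum (F p) (A p)) = (\<Sum>p\<le>n. sum (F (Suc p)) (A (Suc p)))"
    by (subst sum.atMost_Suc_shift) (simp add: A_def)
  also have "\<dots> = (\<Sum>p\<le>n. \<Sum>\<tau>\<in>shuffle_perms p (n - p). F (Suc p) (insert_zero 0 \<tau>))"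
    by (simp add: A sum.reindex inj_on_subset[OF inj_insert_zero])
  also have "(\<Sum>p\<le>Suc n. sum (F p) (B p)) = (\<Sum>p\<le>n. sum (F p) (B p))"
    by (simp add: B_def)
  also have "\<dots> = (\<Sum>p\<le>n. \<Sum>\<tau>\<in>shuffle_perms p (n - p). F p (insert_zero p \<tau>))"
    by (rule sum.cong) (simp_all add: B sum.reindex inj_on_subset[OF inj_insert_zero])
  finally show ?thesis .
qed

section \<open>The wedge product\<close>

definition lwedge :: "('s, 'r::comm_ring_1) lform \<Rightarrow> ('s, 'r) lform \<Rightarrow> ('s, 'r) lform" where
  "lwedge \<eta> \<zeta> = (\<lambda>Vs. \<Sum>p\<le>length Vs. \<Sum>\<sigma>\<in>shuffle_perms p (length Vs - p).
     of_int (sign \<sigma>) * \<eta> (map (\<lambda>k. Vs ! \<sigma> k) [0..<p]) * \<zeta> (map (\<lambda>k. Vs ! \<sigma> k) [p..<length Vs]))"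

text \<open>This is the grading involution. It provides the sign (-1)^p in every degree at once, so
  that the graded Leibniz rules make sense for inhomogeneous forms.\<close>

definition parity :: "('s, 'r::comm_ring_1) lform \<Rightarrow> ('s, 'r) lform" where
  "parity \<eta> = (\<lambda>Vs. (- 1) ^ length Vs * \<eta> Vs)"

lemma lwedge_Nil: "lwedge \<eta> \<zeta> [] = \<eta> [] * \<zeta> []"
proof -
  have "shuffle_perms 0 0 = {id}"
    by (auto simp: shuffle_perms_def permutes_empty)
  then show ?thesis by (simp add: lwedge_def)
qed

text \<open>If V goes to the second factor, its index 0 is inserted at position p, at the cost of
  (-1)^p. Since \<eta> then has exactly p arguments, \<open>parity \<eta>\<close> absorbs the
  sign.\<close>

lemma lwedge_Cons: "lwedge \<eta> \<zeta> (V # Vs) = lwedge (ins V \<eta>) \<zeta> Vs + lwedge (parity \<eta>) (ins V \<zeta>) Vs"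
proof -
  let ?n = "length Vs"
  have 1: "map (\<lambda>k. (V # Vs) ! insert_zero 0 \<tau> k) [0..<Suc p] = V # map (\<lambda>k. Vs ! \<tau> k) [0..<p]"
    "map (\<lambda>k. (V # Vs) ! insert_zero 0 \<tau> k) [Suc p..<Suc m] = map (\<lambda>k. Vs ! \<tau> k) [p..<m]" for \<tau> p m
    unfolding upt_conv_Cons[OF zero_less_Suc] map_Suc_upt[symmetric]
    by (simp_all add: insert_zero_def map_Suc_upt[symmetric] del: upt_Suc)
  have 2: "map (\<lambda>k. (V # Vs) ! insert_zero p \<tau> k) [0..<p] = map (\<lambda>k. Vs ! \<tau> k) [0..<p]" for \<tau> p
    by (auto simp: insert_zero_def)
  have 3: "map (\<lambda>k. (V # Vs) ! insert_zero p \<tau> k) [p..<Suc m] = V # map (\<lambda>k. Vs ! \<tau> k) [p..<m]"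
    if "p \<le> m" for \<tau> p m
  proof -
    have "[p..<Suc m] = p # map Suc [p..<m]"
      using that by (simp add: upt_conv_Cons map_Suc_upt del: upt_Suc)
    then show ?thesis by (auto simp: insert_zero_def)
  qed
  have sg: "sign (insert_zero 0 \<tau>) = sign \<tau>" "sign (insert_zero p \<tau>) = (- 1) ^ p * sign \<tau>"
    if "\<tau> \<in> shuffle_perms p (?n - p)" "p \<le> ?n" for \<tau> p
    using that insert_zero_permutes(2)[of \<tau> ?n] by (simp_all add: shuffle_perms_def)
  have "lwedge \<eta> \<zeta> (V # Vs) =
      (\<Sum>p\<le>?n. \<Sum>\<tau>\<in>shuffle_perms p (?n - p). of_int (sign (insert_zero 0 \<tau>))
        * \<eta> (V # map (\<lambda>k. Vs ! \<tau> k) [0..<p]) * \<zeta> (map (\<lambda>k. Vs ! \<tau> k) [p..<?n])) +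
      (\<Sum>p\<le>?n. \<Sum>\<tau>\<in>shuffle_perms p (?n - p). of_int (sign (insert_zero p \<tau>))
        * \<eta> (map (\<lambda>k. Vs ! \<tau> k) [0..<p]) * \<zeta> (V # map (\<lambda>k. Vs ! \<tau> k) [p..<?n]))"
    unfolding lwedge_def length_Cons sum_shuffles_Suc 1 2 by (simp add: 3 del: upt_Suc)
  also have "\<dots> = lwedge (ins V \<eta>) \<zeta> Vs + lwedge (parity \<eta>) (ins V \<zeta>) Vs"
    unfolding lwedge_def
    by (intro arg_cong2[where f = "(+)"] sum.cong refl) (simp_all add: sg ins_apply parity_def)
  finally show ?thesis .
qed

lemma ins_parity [simp]: "ins V (parity \<eta>) = - parity (ins V \<eta>)"
  by (rule ext) (simp add: ins_apply parity_def)

lemma parity_parity [simp]: "parity (parity \<eta>) = \<eta>"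
  by (rule ext) (simp add: parity_def mult.assoc[symmetric] power_mult_distrib[symmetric])

lemma parity_simps [simp]:
  fixes \<eta> \<zeta> :: "('s, 'r::comm_ring_1) lform"
  shows "parity (\<eta> + \<zeta>) = parity \<eta> + parity \<zeta>" "parity (\<eta> - \<zeta>) = parity \<eta> - parity \<zeta>" "parity (- \<eta>) = - parity \<eta>"
    "parity (fscale f \<eta>) = fscale f (parity \<eta>)" "parity (0 :: ('s, 'r) lform) = 0"
  by (simp_all add: fun_eq_iff parity_def algebra_simps)

lemma lwedge_add_left: "lwedge (\<eta> + \<eta>') \<zeta> = lwedge \<eta> \<zeta> + lwedge \<eta>' \<zeta>"
proof
  fix Vs show "lwedge (\<eta> + \<eta>') \<zeta> Vs = (lwedge \<eta> \<zeta> + lwedge \<eta>' \<zeta>) Vs"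
    by (induction Vs arbitrary: \<eta> \<eta>' \<zeta>) (simp_all add: lwedge_Nil lwedge_Cons algebra_simps)
qed

lemma lwedge_add_right: "lwedge \<eta> (\<zeta> + \<zeta>') = lwedge \<eta> \<zeta> + lwedge \<eta> \<zeta>'"
proof
  fix Vs show "lwedge \<eta> (\<zeta> + \<zeta>') Vs = (lwedge \<eta> \<zeta> + lwedge \<eta> \<zeta>') Vs"
    by (induction Vs arbitrary: \<eta> \<zeta> \<zeta>') (simp_all add: lwedge_Nil lwedge_Cons algebra_simps)
qed

lemma lwedge_uminus_left: "lwedge (- \<eta>) \<zeta> = - lwedge \<eta> \<zeta>"
proof
  fix Vs show "lwedge (- \<eta>) \<zeta> Vs = (- lwedge \<eta> \<zeta>) Vs"
    by (induction Vs arbitrary: \<eta> \<zeta>) (simp_all add: lwedge_Nil lwedge_Cons)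
qed

lemma lwedge_uminus_right: "lwedge \<eta> (- \<zeta>) = - lwedge \<eta> \<zeta>"
proof
  fix Vs show "lwedge \<eta> (- \<zeta>) Vs = (- lwedge \<eta> \<zeta>) Vs"
    by (induction Vs arbitrary: \<eta> \<zeta>) (simp_all add: lwedge_Nil lwedge_Cons)
qed

lemma lwedge_fscale_left: "lwedge (fscale f \<eta>) \<zeta> = fscale f (lwedge \<eta> \<zeta>)"
proof
  fix Vs show "lwedge (fscale f \<eta>) \<zeta> Vs = fscale f (lwedge \<eta> \<zeta>) Vs"
    by (induction Vs arbitrary: \<eta> \<zeta>) (simp_all add: lwedge_Nil lwedge_Cons algebra_simps)
qed

lemma lwedge_fscale_right: "lwedge \<eta> (fscale f \<zeta>) = fscale f (lwedge \<eta> \<zeta>)"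
proof
  fix Vs show "lwedge \<eta> (fscale f \<zeta>) Vs = fscale f (lwedge \<eta> \<zeta>) Vs"
    by (induction Vs arbitrary: \<eta> \<zeta>) (simp_all add: lwedge_Nil lwedge_Cons algebra_simps)
qed

lemma lwedge_diff_left: "lwedge (\<eta> - \<eta>') \<zeta> = lwedge \<eta> \<zeta> - lwedge \<eta>' \<zeta>"
  using lwedge_add_left[of \<eta> "- \<eta>'" \<zeta>] by (simp add: lwedge_uminus_left)

lemma lwedge_diff_right: "lwedge \<eta> (\<zeta> - \<zeta>') = lwedge \<eta> \<zeta> - lwedge \<eta> \<zeta>'"
  using lwedge_add_right[of \<eta> \<zeta> "- \<zeta>'"] by (simp add: lwedge_uminus_right)

lemma lwedge_zero_left: "lwedge 0 \<zeta> = 0"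
  using lwedge_add_left[of 0 0 \<zeta>] by simp

lemma lwedge_zero_right: "lwedge \<eta> 0 = 0"
  using lwedge_add_right[of \<eta> 0 0] by simp

lemma ins_lwedge: "ins V (lwedge \<eta> \<zeta>) = lwedge (ins V \<eta>) \<zeta> + lwedge (parity \<eta>) (ins V \<zeta>)"
  by (rule ext) (simp add: ins_apply lwedge_Cons)

section \<open>Leibniz rules of the Lie derivative and of d for the wedge product\<close>

context lie_rinehart
begin

lemma form_parity:
  assumes "form \<eta>"
  shows "form (parity \<eta>)"
proof (rule formI)
  have "(- 1) ^ n \<in> C" for n
    by (induction n) (simp_all add: C_one C_minus)
  then show "parity \<eta> Vs \<in> C" for Vs
    by (simp add: parity_def C_mult form_C assms)
  show "parity \<eta> (Us @ V # W # Vs) = - parity \<eta> (Us @ W # V # Vs)" for Us V W Vs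
    using form_skew[OF assms, of Us V W Vs] by (simp add: parity_def)
qed (simp_all add: parity_def form_outside[OF assms] form_add_left[OF assms] form_smul[OF assms]
    algebra_simps)

lemma lie_parity:
  assumes "form \<eta>" "V \<in> X"
  shows "lie V (parity \<eta>) = parity (lie V \<eta>)"
proof
  fix Vs show "lie V (parity \<eta>) Vs = parity (lie V \<eta>) Vs"
    using assms
  proof (induction Vs arbitrary: \<eta> rule: sect_list_induct)
    case (outside Vs)
    then show ?case by (simp add: lie_outside parity_def[of "lie V \<eta>"])
  next
    case Nil
    then show ?case by (simp add: lie_Nil parity_def)
  next
    case (Cons W Vs)
    have "lie V (parity (ins W \<eta>)) Vs = parity (lie V (ins W \<eta>)) Vs"
      by (rule Cons.IH) (use Cons in \<open>simp_all add: form_intros\<close>)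
    then show ?case
      using Cons.prems Cons.hyps
      by (simp add: lie_Cons form_parity form_intros lie_uminus)
        (simp add: parity_def lie_Cons algebra_simps)
  qed
qed

lemma d_parity:
  assumes "form \<eta>"
  shows "d (parity \<eta>) = - parity (d \<eta>)"
proof
  fix Vs show "d (parity \<eta>) Vs = (- parity (d \<eta>)) Vs"
    using assms
  proof (induction Vs arbitrary: \<eta> rule: sect_list_induct)
    case (outside Vs)
    then show ?case by (simp add: d_outside parity_def[of "d \<eta>"])
  next
    case Nil
    then show ?case by (simp add: d_Nil parity_def[of "d \<eta>"])
  next
    case (Cons W Vs)
    have "d (parity (ins W \<eta>)) Vs = (- parity (d (ins W \<eta>))) Vs"
      by (rule Cons.IH) (use Cons in \<open>simp_all add: form_intros\<close>)
    then show ?case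
      using Cons.prems Cons.hyps
      by (simp add: d_Cons form_parity form_intros lie_parity d_uminus)
        (simp add: parity_def d_Cons algebra_simps)
  qed
qed

lemma lwedge_outside:
  "form \<eta> \<Longrightarrow> form \<zeta> \<Longrightarrow> \<not> set Vs \<subseteq> X \<Longrightarrow> lwedge \<eta> \<zeta> Vs = 0"
proof (induction Vs arbitrary: \<eta> \<zeta>)
  case (Cons V Vs)
  show ?case
  proof (cases "V \<in> X")
    case True
    then have "\<not> set Vs \<subseteq> X" using Cons.prems by simp
    then show ?thesis using Cons.IH Cons.prems True by (simp add: lwedge_Cons form_intros form_parity)
  next
    case False
    then show ?thesis
      using Cons.prems by (simp add: lwedge_Cons form_ins_outside lwedge_zero_left lwedge_zero_right)
  qed
qed simp

lemma form_lwedge: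
  assumes "form \<eta>" "form \<zeta>"
  shows "form (lwedge \<eta> \<zeta>)"
proof (rule formI)
  show "lwedge \<eta> \<zeta> Vs = 0" if "\<not> set Vs \<subseteq> X" for Vs
    using assms that by (rule lwedge_outside)
  show "lwedge \<eta> \<zeta> Vs \<in> C" for Vs
    using assms by (induction Vs arbitrary: \<eta> \<zeta> rule: sect_list_induct)
      (simp_all add: lwedge_outside lwedge_Nil lwedge_Cons form_intros form_parity)
  show "lwedge \<eta> \<zeta> (add A B # Vs) = lwedge \<eta> \<zeta> (A # Vs) + lwedge \<eta> \<zeta> (B # Vs)"
    if "A \<in> X" "B \<in> X" for A B Vs
    using assms that by (simp add: lwedge_Cons ins_add lwedge_add_left lwedge_add_right algebra_simps)
  show "lwedge \<eta> \<zeta> (smul f A # Vs) = f * lwedge \<eta> \<zeta> (A # Vs)" if "f \<in> C" "A \<in> X" for f A Vs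
    using assms that
    by (simp add: lwedge_Cons ins_smul lwedge_fscale_left lwedge_fscale_right algebra_simps)
  show "lwedge \<eta> \<zeta> (Us @ A # B # Vs) = - lwedge \<eta> \<zeta> (Us @ B # A # Vs)" for Us A B Vs
    using assms
  proof (induction Us arbitrary: \<eta> \<zeta>)
    case Nil
    \<comment> \<open>Inserting A and then B yields the mixed terms
      \<open>lwedge (parity (ins A \<eta>)) (ins B \<zeta>)\<close> and
      \<open>- lwedge (parity (ins B \<eta>)) (ins A \<zeta>)\<close>. The minus comes from passing
      an insertion through \<open>parity\<close>, and together they are antisymmetric in A and
      B.\<close>
    then show ?case
      by (simp add: lwedge_Cons lwedge_uminus_left lwedge_uminus_right
          ins_swap[of \<eta> B A] ins_swap[of \<zeta> B A])
  next
    case (Cons U Us)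
    show ?case
    proof (rule skew_induct_step[where F = "lwedge \<eta> \<zeta>", OF _ _ lwedge_outside[OF Cons.prems]])
      fix Us' U' assume "U # Us = U' # Us'" "U' \<in> X"
      then have "U \<in> X" by simp
      then show "lwedge \<eta> \<zeta> ((U # Us) @ A # B # Vs) = - lwedge \<eta> \<zeta> ((U # Us) @ B # A # Vs)"
        using Cons.prems Cons.IH[OF form_ins, of \<eta> U \<zeta>] Cons.IH[OF form_parity form_ins, of \<eta> \<zeta> U]
        by (simp add: lwedge_Cons)
    qed simp_all
  qed
qed

lemma lie_lwedge:
  assumes "form \<eta>" "form \<zeta>" "V \<in> X"
  shows "lie V (lwedge \<eta> \<zeta>) = lwedge (lie V \<eta>) \<zeta> + lwedge \<eta> (lie V \<zeta>)"
proof
  fix Vs show "lie V (lwedge \<eta> \<zeta>) Vs = (lwedge (lie V \<eta>) \<zeta> + lwedge \<eta> (lie V \<zeta>)) Vs"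
    using assms
  proof (induction Vs arbitrary: \<eta> \<zeta> rule: sect_list_induct)
    case (outside Vs)
    then show ?case by (simp add: lie_outside lwedge_outside form_lie)
  next
    case Nil
    then show ?case by (simp add: lie_Nil lwedge_Nil L_mult form_intros algebra_simps)
  next
    case (Cons W Vs)
    then show ?case
      by (simp add: lie_Cons form_lwedge ins_lwedge lie_add form_intros form_parity form_lie lwedge_Cons
          ins_lie lwedge_diff_left lwedge_diff_right lie_parity)
  qed
qed

text \<open>Cartan's formula reduces the claim to the derivation property of L(V) and to the
  induction hypothesis for the pairs i(V)\<eta>, \<zeta> and \<open>parity \<eta>\<close>,
  i(V)\<zeta>. Both d and i(V) anticommute with \<open>parity\<close>, which makes the mixed terms
  agree.\<close>

theorem d_lwedge:
  assumes "form \<eta>" "form \<zeta>"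
  shows "d (lwedge \<eta> \<zeta>) = lwedge (d \<eta>) \<zeta> + lwedge (parity \<eta>) (d \<zeta>)"
proof
  fix Vs show "d (lwedge \<eta> \<zeta>) Vs = (lwedge (d \<eta>) \<zeta> + lwedge (parity \<eta>) (d \<zeta>)) Vs"
    using assms
  proof (induction Vs arbitrary: \<eta> \<zeta> rule: sect_list_induct)
    case (outside Vs)
    then show ?case by (simp add: d_outside lwedge_outside form_d form_parity)
  next
    case Nil
    then show ?case by (simp add: d_Nil lwedge_Nil)
  next
    case (Cons V Vs)
    then show ?case
      by (simp add: d_Cons form_lwedge ins_lwedge d_add form_intros form_parity form_d form_lie lwedge_Cons
          ins_d lwedge_diff_left lwedge_diff_right lie_lwedge d_parity lwedge_uminus_left)
  qed
qed

end

section \<open>Repeated arguments, degrees and constant factors\<close>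

context lie_rinehart
begin

lemma form_sum: "(\<And>i. i \<in> I \<Longrightarrow> form (\<omega> i)) \<Longrightarrow> form (\<Sum>i\<in>I. \<omega> i)"
  by (induction I rule: infinite_finite_induct) (simp_all add: form_zero form_add)

text \<open>Skew symmetry only says that a value with two equal arguments is its own negative, so
  2-torsion has to be excluded; real functions have none.\<close>

lemma form_repeated:
  assumes "form \<omega>" "set Vs \<subseteq> X" "\<not> distinct Vs" and torsion_free: "\<And>f :: 'r. f = - f \<Longrightarrow> f = 0"
  shows "\<omega> Vs = 0"
proof -
  obtain i j where ij: "i < length Vs" "j < length Vs" "i \<noteq> j" "Vs ! i = Vs ! j"
    using assms(3) by (auto simp: distinct_conv_nth)
  define y where "y = Vs ! i"
  define Rest where "Rest = nths Vs (- {i})"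
  have "y \<in> X" using ij assms(2) by (auto simp: y_def)
  have "y \<in> set Rest" using ij unfolding y_def Rest_def set_nths by auto
  \<comment> \<open>The other copy of y survives the removal of position i. Moving it to the front
    of \<open>Rest\<close> brings the equal arguments side by side.\<close>
  then obtain k where k: "k < length Rest" "Rest ! k = y"
    by (auto simp: in_set_conv_nth)
  have Rest: "set Rest \<subseteq> X" using assms(2) set_nths_subset unfolding Rest_def by fastforce
  have "\<omega> Vs = \<omega> (Vs[i := y])" by (simp add: y_def)
  also have "\<dots> = (- 1) ^ i * \<omega> (y # Rest)"
    unfolding Rest_def by (rule form_move_front[OF assms(1) ij(1) assms(2)])
  also have "\<omega> (y # Rest) = ins y \<omega> (Rest[k := y])"
    using k by (simp add: ins_apply flip: k(2))
  also have "\<dots> = (- 1) ^ k * ins y \<omega> (y # nths Rest (- {k}))"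
    by (rule form_move_front[OF form_ins[OF assms(1) \<open>y \<in> X\<close>] k(1) Rest])
  also have "ins y \<omega> (y # nths Rest (- {k})) = 0"
    using torsion_free[OF form_skew0[OF assms(1), of y y]] by (simp add: ins_apply)
  finally show ?thesis by simp
qed

lemma d_degree:
  assumes "form \<omega>" "\<And>Vs. length Vs \<noteq> p \<Longrightarrow> \<omega> Vs = 0" "length Vs \<noteq> Suc p"
  shows "d \<omega> Vs = 0"
  using assms
proof (induction Vs arbitrary: \<omega> p rule: sect_list_induct)
  case (Cons V Vs)
  have "lie V \<omega> Vs = 0"
    using Cons.prems Cons.hyps by (simp add: lie_def L_zero)
  moreover have "d (ins V \<omega>) Vs = 0"
  proof (cases p)
    case 0
    then have "ins V \<omega> = 0" using Cons.prems by (intro ext) (simp add: ins_apply)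
    then show ?thesis by (simp add: d_zero)
  next
    case (Suc q)
    then show ?thesis
      using Cons.prems Cons.hyps by (intro Cons.IH[of _ q] form_ins) (simp_all add: ins_apply)
  qed
  ultimately show ?case using Cons.prems Cons.hyps by (simp add: d_Cons)
qed (simp_all add: d_outside d_Nil)

text \<open>The condition on f says df = 0. Applied to constants, this gives the real linearity of
  d.\<close>

lemma d_fscale_const:
  assumes "form \<omega>" "f \<in> C" "\<And>V. V \<in> X \<Longrightarrow> L V f = 0"
  shows "d (fscale f \<omega>) = fscale f (d \<omega>)"
proof
  fix Vs
  have "set Vs \<subseteq> X \<Longrightarrow> df_wedge Vs f \<omega> = 0"
    by (induction Vs arbitrary: \<omega>) (simp_all add: assms(3))
  then show "d (fscale f \<omega>) Vs = fscale f (d \<omega>) Vs"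
    by (cases "set Vs \<subseteq> X") (simp_all add: d_fscale assms d_outside)
qed

end

section \<open>The exterior derivative of a Lie algebroid\<close>

text \<open>The abstract forms have values in the pointwise ring of functions, while the given
  definitions compute with real numbers at a point x. Evaluation at x translates between
  them.\<close>

lemma sum_fun_apply: "sum f A x = (\<Sum>i\<in>A. f i x)"
  by (induction A rule: infinite_finite_induct) simp_all

lemma minus_one_power_fun_apply: "((- 1) ^ n :: 'a \<Rightarrow> real) x = (- 1) ^ n"
  by (induction n) simp_all

lemma of_int_sign_fun_apply: "(of_int (sign \<sigma>) :: 'a \<Rightarrow> real) x = of_int (sign \<sigma>)"
  by (cases \<sigma> rule: sign_cases) simp_all

context algebroid
begin

sublocale cartan: lie_rinehart C "A1 G" "sadd G" "smult G" "bracket G" "lie_fun G"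
proof
  show "1 \<in> C" unfolding one_fun_def by (rule C_const)
  show "bracket G V W = smult G (- 1) (bracket G W V)" if "V \<in> A1 G" "W \<in> A1 G" for V W
    using bracket_skew[OF that] by (simp add: one_fun_def fun_Compl_def)
qed (rule C_add C_minus C_mult sadd_closed smult_closed bracket_closed lie_fun_closed lie_fun_add
    lie_fun_mult lie_fun_sadd lie_fun_smult lie_fun_bracket bracket_sadd bracket_Jacobi
    bracket_Leibniz bracket_Leibniz_left; assumption)+

section \<open>Translation between the given forms and the abstract ones\<close>

lemma insert_sect_eq: "insert_sect V \<omega> = ins V \<omega>"
  by (simp add: insert_sect_def ins_def)

lemma lie_form_eq: "lie_form G V \<omega> = cartan.lie V \<omega>"
  by (intro ext) (simp add: lie_form_def cartan.lie_def sum_fun_apply)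

lemma d_rho_eq: "d_rho G \<omega> = cartan.d \<omega>"
  by (intro ext) (simp add: d_rho_def cartan.d_def sum_fun_apply minus_one_power_fun_apply)

lemma wedge_eq: "wedge \<eta> \<zeta> = lwedge \<eta> \<zeta>"
  by (intro ext) (simp add: wedge_def lwedge_def sum_fun_apply of_int_sign_fun_apply)

lemma Omega_deg_neg: "p < 0 \<Longrightarrow> Omega_deg G p = {0}"
  by (simp add: Omega_deg_def zero_fun_def)

text \<open>Polarization in two adjacent slots: the value with V + W in both is 0, as are those with
  V twice and with W twice.\<close>

lemma Omega_deg_skew:
  assumes "\<omega> \<in> Omega_deg G (int p)"
  shows "\<omega> (Us @ V # W # Vs) = - \<omega> (Us @ W # V # Vs)"
proof (cases "length (Us @ V # W # Vs) = p \<and> set (Us @ V # W # Vs) \<subseteq> A1 G")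
  case False
  then have "\<not> (length (Us @ W # V # Vs) = p \<and> set (Us @ W # V # Vs) \<subseteq> A1 G)" by auto
  then show ?thesis
    using assms False by (simp add: Omega_deg_def fun_eq_iff del: length_append set_append)
next
  case True
  have dist: "\<omega> Xs = (\<lambda>_. 0)" if "length Xs = p" "set Xs \<subseteq> A1 G" "\<not> distinct Xs" for Xs
    using assms that by (simp add: Omega_deg_def)
  have add: "\<omega> (Xs[i := sadd G s t]) = (\<lambda>x. \<omega> (Xs[i := s]) x + \<omega> (Xs[i := t]) x)"
    if "length Xs = p" "set Xs \<subseteq> A1 G" "i < length Xs" "s \<in> A1 G" "t \<in> A1 G" for Xs i s t
    using assms that by (simp add: Omega_deg_def)
  let ?F = "\<lambda>A B. \<omega> (Us @ A # B # Vs)"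
  have X: "V \<in> A1 G" "W \<in> A1 G" "set Us \<subseteq> A1 G" "set Vs \<subseteq> A1 G" and len: "Suc (Suc (length Us + length Vs)) = p"
    using True by auto
  have S: "sadd G V W \<in> A1 G" using X by (intro sadd_closed)
  have add1: "?F (sadd G V W) B = (\<lambda>x. ?F V B x + ?F W B x)" if "B \<in> A1 G" for B
    using add[of "Us @ V # B # Vs" "length Us" V W] X len that by simp
  have add2: "?F A (sadd G V W) = (\<lambda>x. ?F A V x + ?F A W x)" if "A \<in> A1 G" for A
    using add[of "Us @ A # V # Vs" "Suc (length Us)" V W] X len that
    by (simp add: list_update_append)
  have "?F V V = (\<lambda>_. 0)" "?F W W = (\<lambda>_. 0)" "?F (sadd G V W) (sadd G V W) = (\<lambda>_. 0)"
    using X S len by (auto intro!: dist)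
  then show ?thesis
    using add1[OF S] add2[OF X(1)] add2[OF X(2)] by (simp add: fun_eq_iff eq_neg_iff_add_eq_0)
qed

text \<open>From left to right, alternation becomes skew symmetry by polarization. Conversely,
  moving an argument to the front spreads linearity to all slots, and the lack of 2-torsion makes
  skew forms alternating.\<close>

lemma Omega_deg_iff:
  "\<omega> \<in> Omega_deg G (int p) \<longleftrightarrow> cartan.form \<omega> \<and> (\<forall>Vs. length Vs \<noteq> p \<longrightarrow> \<omega> Vs = 0)"
proof
  assume \<omega>: "\<omega> \<in> Omega_deg G (int p)"
  have out: "\<omega> Vs = 0" if "\<not> (length Vs = p \<and> set Vs \<subseteq> A1 G)" for Vs
    using \<omega> that unfolding Omega_deg_def zero_fun_def by auto
  have inn: "\<omega> Vs \<in> C"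
      "i < length Vs \<Longrightarrow> s \<in> A1 G \<Longrightarrow> t \<in> A1 G \<Longrightarrow>
         \<omega> (Vs[i := sadd G s t]) = (\<lambda>x. \<omega> (Vs[i := s]) x + \<omega> (Vs[i := t]) x)"
      "i < length Vs \<Longrightarrow> s \<in> A1 G \<Longrightarrow> f \<in> C \<Longrightarrow> \<omega> (Vs[i := smult G f s]) = (\<lambda>x. f x * \<omega> (Vs[i := s]) x)"
    if "length Vs = p" "set Vs \<subseteq> A1 G" for Vs i s t f
    using \<omega> that unfolding Omega_deg_def by simp_all
  have "cartan.form \<omega>"
  proof (rule cartan.formI)
    show "\<omega> Vs = 0" if "\<not> set Vs \<subseteq> A1 G" for Vs
      using out that by blast
    show "\<omega> Vs \<in> C" for Vs
      using out[of Vs] inn(1)[of Vs] C_zero by metis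
    show "\<omega> (sadd G V W # Vs) = \<omega> (V # Vs) + \<omega> (W # Vs)" if "V \<in> A1 G" "W \<in> A1 G" for V W Vs
    proof (cases "Suc (length Vs) = p \<and> set Vs \<subseteq> A1 G")
      case True
      then show ?thesis using inn(2)[of "V # Vs" 0 V W] that by (simp add: plus_fun_def)
    next
      case False
      then show ?thesis
        using out[of "sadd G V W # Vs"] out[of "V # Vs"] out[of "W # Vs"] by auto
    qed
    show "\<omega> (smult G f V # Vs) = f * \<omega> (V # Vs)" if "f \<in> C" "V \<in> A1 G" for f V Vs
    proof (cases "Suc (length Vs) = p \<and> set Vs \<subseteq> A1 G")
      case True
      then show ?thesis using inn(3)[of "V # Vs" 0 V f] that by (simp add: times_fun_def)
    next
      case False
      then show ?thesis
        using out[of "smult G f V # Vs"] out[of "V # Vs"] by auto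
    qed
    show "\<omega> (Us @ V # W # Vs) = - \<omega> (Us @ W # V # Vs)" for Us V W Vs
      by (rule Omega_deg_skew[OF \<omega>])
  qed
  then show "cartan.form \<omega> \<and> (\<forall>Vs. length Vs \<noteq> p \<longrightarrow> \<omega> Vs = 0)"
    using out by blast
next
  assume a: "cartan.form \<omega> \<and> (\<forall>Vs. length Vs \<noteq> p \<longrightarrow> \<omega> Vs = 0)"
  then have f: "cartan.form \<omega>" by blast
  have rep: "\<omega> Vs = (\<lambda>_. 0)" if "set Vs \<subseteq> A1 G" "\<not> distinct Vs" for Vs
    using cartan.form_repeated[OF f that] by (simp add: zero_fun_def fun_eq_iff)
  have out: "\<omega> Vs = (\<lambda>_. 0)" if "\<not> (length Vs = p \<and> set Vs \<subseteq> A1 G)" for Vs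
    using a that cartan.form_outside[OF f] unfolding zero_fun_def by blast
  have add: "\<omega> (Vs[i := sadd G s t]) = (\<lambda>x. \<omega> (Vs[i := s]) x + \<omega> (Vs[i := t]) x)"
    if "set Vs \<subseteq> A1 G" "i < length Vs" "s \<in> A1 G" "t \<in> A1 G" for Vs i s t
    unfolding cartan.form_move_front[OF f that(2,1)] cartan.form_add_left[OF f that(3,4)]
    by (simp add: fun_eq_iff algebra_simps)
  have mul: "\<omega> (Vs[i := smult G g s]) = (\<lambda>x. g x * \<omega> (Vs[i := s]) x)"
    if "set Vs \<subseteq> A1 G" "i < length Vs" "s \<in> A1 G" "g \<in> C" for Vs i s g
    unfolding cartan.form_move_front[OF f that(2,1)] cartan.form_smul[OF f that(4,3)]
    by (simp add: fun_eq_iff algebra_simps)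
  show "\<omega> \<in> Omega_deg G (int p)"
    unfolding Omega_deg_def using out rep add mul cartan.form_C[OF f] by simp
qed

text \<open>This brings inhomogeneous elements under the abstract calculus directly, without
  splitting them into components.\<close>

lemma Omega_form: "\<omega> \<in> Omega G \<Longrightarrow> cartan.form \<omega>"
proof -
  assume "\<omega> \<in> Omega G"
  then obtain N :: nat and \<eta> where \<eta>: "\<And>p. p \<le> N \<Longrightarrow> \<eta> p \<in> Omega_deg G (int p)"
    and \<omega>: "\<omega> = (\<lambda>Vs x. \<Sum>p\<le>N. \<eta> p Vs x)"
    unfolding Omega_def by blast
  have "\<omega> = (\<Sum>p\<le>N. \<eta> p)"
    unfolding \<omega> by (intro ext) (simp add: sum_fun_apply)
  then show ?thesis
    using \<eta> by (auto intro: cartan.form_sum simp: Omega_deg_iff)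
qed

lemma Omega_deg_cases:
  assumes "\<eta> \<in> Omega_deg G p"
  obtains "p < 0" "\<eta> = 0" | n where "p = int n" "cartan.form \<eta>" "\<And>Vs. length Vs \<noteq> n \<Longrightarrow> \<eta> Vs = 0"
proof (cases "p < 0")
  case True
  then show ?thesis using that(1) assms by (simp add: Omega_deg_neg)
next
  case False
  then obtain n where n: "p = int n" by (metis int_nat_eq not_less)
  then show ?thesis using that(2)[OF n] assms by (simp add: Omega_deg_iff)
qed

lemma lie_form_Cartan:
  assumes "cartan.form \<omega>" "V \<in> A1 G"
  shows "lie_form G V \<omega> = (\<lambda>Vs x. insert_sect V (d_rho G \<omega>) Vs x + d_rho G (insert_sect V \<omega>) Vs x)"
  using cartan.ins_d[OF assms]
  by (simp add: lie_form_eq d_rho_eq insert_sect_eq fun_eq_iff)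

lemma d_rho_Omega_deg:
  assumes "\<eta> \<in> Omega_deg G p"
  shows "d_rho G \<eta> \<in> Omega_deg G (p + 1)"
  using assms
proof (cases rule: Omega_deg_cases)
  case 1
  have "(0 :: ('m, 'v) form) \<in> Omega_deg G (p + 1)"
  proof (cases "p + 1 < 0")
    case False
    \<comment> \<open>Only p = -1 is left, where the zero form has to be recognized as an element of
      degree 0.\<close>
    with 1 have "p + 1 = int 0" by simp
    then show ?thesis by (simp only: Omega_deg_iff) (simp add: cartan.form_zero)
  qed (simp add: Omega_deg_neg)
  then show ?thesis
    using 1 by (simp add: d_rho_eq cartan.d_zero)
next
  case (2 n)
  have "d_rho G \<eta> \<in> Omega_deg G (int (Suc n))"
    unfolding Omega_deg_iff d_rho_eq
    using cartan.form_d[OF 2(2)] cartan.d_degree[OF 2(2,3)] by blast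
  then show ?thesis using 2(1) by (simp add: add.commute)
qed

lemma d_rho_linear:
  assumes "cartan.form \<omega>" "cartan.form \<omega>'"
  shows "d_rho G (\<lambda>Vs x. a * \<omega> Vs x + b * \<omega>' Vs x) =
           (\<lambda>Vs x. a * d_rho G \<omega> Vs x + b * d_rho G \<omega>' Vs x)"
proof -
  have "(\<lambda>Vs x. a * \<omega> Vs x + b * \<omega>' Vs x) = fscale (\<lambda>_. a) \<omega> + fscale (\<lambda>_. b) \<omega>'"
    by (intro ext) simp
  then show ?thesis
    using assms
    by (simp add: d_rho_eq cartan.d_add cartan.form_fscale C_const cartan.d_fscale_const lie_fun_const)
      (simp add: fun_eq_iff)
qed

lemma d_rho_wedge:
  assumes "\<eta> \<in> Omega_deg G p" "cartan.form \<zeta>"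
  shows "d_rho G (wedge \<eta> \<zeta>) =
    (\<lambda>Vs x. wedge (d_rho G \<eta>) \<zeta> Vs x + (-1) powi p * wedge \<eta> (d_rho G \<zeta>) Vs x)"
  using assms(1)
proof (cases rule: Omega_deg_cases)
  case 1
  then show ?thesis
    unfolding 1(2) d_rho_eq wedge_eq lwedge_zero_left cartan.d_zero by (simp add: zero_fun_def)
next
  case (2 n)
  \<comment> \<open>On a homogeneous form \<open>parity\<close> is multiplication by a constant
    sign, which can be pulled out of the wedge product.\<close>
  have "parity \<eta> = fscale ((- 1) ^ n) \<eta>"
  proof
    fix Vs show "parity \<eta> Vs = fscale ((- 1) ^ n) \<eta> Vs"
      using 2(3)[of Vs] by (cases "length Vs = n") (simp_all add: parity_def)
  qed
  then have "cartan.d (lwedge \<eta> \<zeta>) = lwedge (cartan.d \<eta>) \<zeta> + fscale ((- 1) ^ n) (lwedge \<eta> (cartan.d \<zeta>))"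
    using cartan.d_lwedge[OF 2(2) assms(2)] by (simp add: lwedge_fscale_left)
  then show ?thesis
    using 2(1) by (simp add: d_rho_eq wedge_eq fun_eq_iff minus_one_power_fun_apply)
qed

end

theorem proposition5p2p3:
  fixes G :: "('m::{t2_space,second_countable_topology}, 'e::fin_euclidean, 'v, 'f::fin_euclidean)
                lie_algebroid_data"
  assumes "lie_algebroid G"
  shows
    "(\<forall>V\<in>A1 G. \<forall>\<omega>\<in>Omega G.
       lie_form G V \<omega> = (\<lambda>Vs x. insert_sect V (d_rho G \<omega>) Vs x + d_rho G (insert_sect V \<omega>) Vs x)) \<and>
     ((\<forall>p. \<forall>\<eta>\<in>Omega_deg G p. d_rho G \<eta> \<in> Omega_deg G (p + 1)) \<and>
      (\<forall>\<omega>\<in>Omega G. \<forall>\<omega>'\<in>Omega G. \<forall>a b :: real.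
         d_rho G (\<lambda>Vs x. a * \<omega> Vs x + b * \<omega>' Vs x) =
           (\<lambda>Vs x. a * d_rho G \<omega> Vs x + b * d_rho G \<omega>' Vs x)) \<and>
      (\<forall>p. \<forall>\<eta>\<in>Omega_deg G p. \<forall>\<zeta>\<in>Omega G.
         d_rho G (wedge \<eta> \<zeta>) =
           (\<lambda>Vs x. wedge (d_rho G \<eta>) \<zeta> Vs x + (-1) powi p * wedge \<eta> (d_rho G \<zeta>) Vs x))) \<and>
     (\<forall>V\<in>A1 G. \<forall>\<omega>\<in>Omega G. lie_form G V (d_rho G \<omega>) = d_rho G (lie_form G V \<omega>)) \<and>
     (\<forall>\<omega>\<in>Omega G. d_rho G (d_rho G \<omega>) = (\<lambda>Vs x. 0))"
proof -
  interpret algebroid G by unfold_locales (rule assms)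
  have "lie_form G V (d_rho G \<omega>) = d_rho G (lie_form G V \<omega>)" if "V \<in> A1 G" "\<omega> \<in> Omega G" for V \<omega>
    unfolding lie_form_eq d_rho_eq using that by (intro cartan.lie_d Omega_form)
  moreover have "d_rho G (d_rho G \<omega>) = (\<lambda>Vs x. 0)" if "\<omega> \<in> Omega G" for \<omega>
    using cartan.d_d[OF Omega_form[OF that]] by (simp add: d_rho_eq zero_fun_def)
  ultimately show ?thesis
    by (intro conjI ballI allI lie_form_Cartan d_rho_Omega_deg d_rho_linear d_rho_wedge Omega_form)
qed

end
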